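(* Let $D$ be an uncountable atomic (or noetherian) integral domain with prime subring $Z$. Assume that there exists an irreducible element $p$ of $D$ such that $1-p\notin U(D)$ and every nonzero element of $Z[p]$ has at most countably many (irreducible) divisors in $D$. Then $D$ is submaximal. In particular, if $D$ is an uncountable atomic (or noetherian) integral domain such that every nonzero element of $D$ has at most countably many (irreducible) divisors, then $D$ is submaximal. Consequently, every uncountable noetherian idf-domain is submaximal.
   Context: All rings are commutative with $1\neq 0$, and a subring of a ring contains the identity of that ring. A maximal subring of $R$ is a proper subring $S\subsetneq R$ such that there is no subring strictly between $S$ and $R$; $R$ is called submaximal if it has at least one maximal subring. The prime subring of $D$ is $Z=\{n\cdot 1_D\mid n\in\mathbb{Z}\}$, and $U(D)$ is the group of units of $D$. An integral domain is atomic if every nonzero non-unit is a finite product of irreducible elements (not necessarily uniquely). An integral domain $D$ is an idf-domain if every nonzero non-unit element of $D$ has at most finitely many irreducible divisors. Irreducible divisors are counted up to associates. "(Irreducible) divisors" means that the hypothesis need only be imposed on irreducible divisors. *)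

theory Defs
  imports "HOL-Algebra.Algebra" "HOL-Algebra.Finite_Extensions" "HOL-Library.Countable_Set"
begin

definition maximal_subring :: "'a set \<Rightarrow> ('a, 'b) ring_scheme \<Rightarrow> bool" where
  "maximal_subring S R \<longleftrightarrow>
     subring S R \<and> S \<noteq> carrier R \<and>
     (\<forall>T. subring T R \<and> S \<subseteq> T \<longrightarrow> T = S \<or> T = carrier R)"

definition submaximal :: "('a, 'b) ring_scheme \<Rightarrow> bool" where
  "submaximal R \<longleftrightarrow> (\<exists>S. maximal_subring S R)"

definition prime_subring :: "('a, 'b) ring_scheme \<Rightarrow> 'a set" where
  "prime_subring R = range (\<lambda>n :: int. [n] \<cdot>\<^bsub>R\<^esub> \<one>\<^bsub>R\<^esub>)"

definition atomic_domain :: "('a, 'b) ring_scheme \<Rightarrow> bool" where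
  "atomic_domain R \<longleftrightarrow>
     domain R \<and>
     (\<forall>a \<in> carrier R - {\<zero>\<^bsub>R\<^esub>} - Units R.
        \<exists>fs. set fs \<subseteq> carrier R \<and> (\<forall>f \<in> set fs. ring_irreducible\<^bsub>R\<^esub> f) \<and>
             foldr (\<otimes>\<^bsub>R\<^esub>) fs \<one>\<^bsub>R\<^esub> = a)"

(* Irreducible divisors are counted up to associates, so this is a set of associate classes. *)
definition irreducible_divisor_classes :: "('a, 'b) ring_scheme \<Rightarrow> 'a \<Rightarrow> 'a set set" where
  "irreducible_divisor_classes R a =
     assocs R ` {q \<in> carrier R. ring_irreducible\<^bsub>R\<^esub> q \<and> q divides\<^bsub>R\<^esub> a}"

definition idf_domain :: "('a, 'b) ring_scheme \<Rightarrow> bool" where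
  "idf_domain R \<longleftrightarrow>
     domain R \<and>
     (\<forall>a \<in> carrier R - {\<zero>\<^bsub>R\<^esub>} - Units R. finite (irreducible_divisor_classes R a))"

end

theory Submission
  imports Defs
begin

text \<open>
  The heart of the matter is that a domain \<open>R\<close> is submaximal as soon as some unit \<open>x\<close> of \<open>R\<close>
  lies in a subring \<open>A\<close> in which \<open>xA\<close> is prime and \<open>\<Inter>\<^sub>k x\<^sup>kA = 0\<close>. Extending \<open>A\<close> by
  transcendental elements preserves this (Gauss), so by Zorn's lemma \<open>R\<close> may be assumed algebraic
  over \<open>A\<close>. Then a maximal subring \<open>S \<supseteq> A\<close> with \<open>xS \<inter> A = xA\<close> behaves like the integral closure
  of a discrete valuation ring: it omits \<open>1/x\<close>, but for every \<open>z \<in> R\<close> some \<open>x\<^sup>kz\<close> lies in \<open>S\<close>,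
  that is, \<open>R = S[1/x]\<close>. A subring maximal among those containing \<open>S\<close> and omitting \<open>1/x\<close> is then
  a maximal subring of \<open>R\<close>.

  If \<open>D\<close> has uncountably many units, one of them is transcendental over the prime subring \<open>Z\<close>, and
  \<open>A = Z[x]\<close> works. Otherwise take a nonzero nonunit \<open>p\<close>. If \<open>p\<close> is transcendental over \<open>Z\<close>, let
  \<open>x = p\<close> and \<open>A = Z[p]\<close>; if not, \<open>p\<close> divides a nonzero integer, so some prime number \<open>x\<close> is a
  nonzero nonunit of \<open>D\<close>, and \<open>A = Z\<close>. The uncountably many elements \<open>1 - xy\<close> cannot all be products
  of the countably many irreducibles that divide nonzero elements of \<open>A\<close>, so some \<open>1 - xy\<close> has an
  irreducible factor \<open>q\<close> dividing no nonzero element of \<open>A\<close>. A prime ideal \<open>P \<supseteq> qD\<close> with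
  \<open>P \<inter> A = 0\<close> makes \<open>x\<close> a unit of \<open>D/P\<close>, to which the first paragraph applies; maximal subrings
  pull back along \<open>D \<rightarrow> D/P\<close>.
\<close>

section \<open>Polynomial expressions of bounded degree\<close>

text \<open>The values \<open>a\<^sub>0 + a\<^sub>1y + \<dots> + a\<^sub>m y\<^sup>m\<close> with \<open>m < n\<close>: the degree stays strictly below \<open>n\<close>.\<close>

primrec (in ring) bounded_polys :: "'a set \<Rightarrow> 'a \<Rightarrow> nat \<Rightarrow> 'a set" where
  "bounded_polys A y 0 = {\<zero>}"
| "bounded_polys A y (Suc n) = {g \<otimes> y \<oplus> a | g a. g \<in> bounded_polys A y n \<and> a \<in> A}"

context cring
begin

lemma bounded_polys_carrier:
  assumes "subring A R" "y \<in> carrier R"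
  shows "bounded_polys A y n \<subseteq> carrier R"
  using assms subringE(1)[OF assms(1)] by (induction n) auto

lemma bounded_polys_SucI:
  "g \<in> bounded_polys A y n \<Longrightarrow> a \<in> A \<Longrightarrow> g \<otimes> y \<oplus> a \<in> bounded_polys A y (Suc n)"
  by auto

lemma bounded_polys_SucE:
  assumes "f \<in> bounded_polys A y (Suc n)"
  obtains g a where "g \<in> bounded_polys A y n" "a \<in> A" "f = g \<otimes> y \<oplus> a"
  using assms by auto

declare bounded_polys.simps(2) [simp del]

lemma zero_in_bounded_polys:
  assumes "subring A R" "y \<in> carrier R"
  shows "\<zero> \<in> bounded_polys A y n"
proof (induction n)
  case (Suc n)
  show ?case
    using bounded_polys_SucI[OF Suc subringE(2)[OF assms(1)]] assms by simp
qed simp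

lemma bounded_polys_times_var:
  assumes "subring A R" "y \<in> carrier R" "g \<in> bounded_polys A y n"
  shows "g \<otimes> y \<in> bounded_polys A y (Suc n)"
  using bounded_polys_SucI[OF assms(3) subringE(2)[OF assms(1)]]
    assms bounded_polys_carrier[OF assms(1,2), of n] by auto

lemma bounded_polys_times_pow:
  assumes "subring A R" "y \<in> carrier R" "g \<in> bounded_polys A y n"
  shows "g \<otimes> y [^] k \<in> bounded_polys A y (n + k)"
proof (induction k)
  case 0
  then show ?case using assms bounded_polys_carrier[OF assms(1,2), of n] by auto
next
  case (Suc k)
  have "g \<in> carrier R"
    using assms bounded_polys_carrier by blast
  then show ?case
    using bounded_polys_times_var[OF assms(1,2) Suc] assms(2) by (simp add: m_assoc)
qed

lemma const_in_bounded_polys: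
  assumes "subring A R" "y \<in> carrier R" "a \<in> A"
  shows "a \<in> bounded_polys A y (Suc n)"
  using bounded_polys_SucI[OF zero_in_bounded_polys[OF assms(1,2)] assms(3), of n]
    assms subringE(1)[OF assms(1)] by auto

lemma bounded_polys_add:
  assumes "subring A R" "y \<in> carrier R" "f \<in> bounded_polys A y n" "g \<in> bounded_polys A y n"
  shows "f \<oplus> g \<in> bounded_polys A y n"
  using assms(3,4)
proof (induction n arbitrary: f g)
  case (Suc n)
  obtain f' a g' b where *: "f = f' \<otimes> y \<oplus> a" "g = g' \<otimes> y \<oplus> b" "a \<in> A" "b \<in> A"
      "f' \<in> bounded_polys A y n" "g' \<in> bounded_polys A y n"
    using bounded_polys_SucE[OF Suc.prems(1)] bounded_polys_SucE[OF Suc.prems(2)] by metis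
  have "f' \<in> carrier R" "g' \<in> carrier R" "a \<in> carrier R" "b \<in> carrier R"
    using * bounded_polys_carrier[OF assms(1,2)] subringE(1)[OF assms(1)] by auto
  then have "f \<oplus> g = (f' \<oplus> g') \<otimes> y \<oplus> (a \<oplus> b)"
    using * assms(2) by (simp add: l_distr a_ac)
  then show ?case
    using bounded_polys_SucI[OF Suc.IH[OF *(5,6)] subringE(7)[OF assms(1) *(3,4)]] by simp
qed simp

lemma bounded_polys_smult:
  assumes "subring A R" "y \<in> carrier R" "c \<in> A" "f \<in> bounded_polys A y n"
  shows "c \<otimes> f \<in> bounded_polys A y n"
  using assms(4)
proof (induction n arbitrary: f)
  case 0
  then show ?case using assms subringE(1)[OF assms(1)] by auto
next
  case (Suc n)
  obtain f' a where *: "f = f' \<otimes> y \<oplus> a" "a \<in> A" "f' \<in> bounded_polys A y n"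
    using bounded_polys_SucE[OF Suc.prems] by metis
  have "f' \<in> carrier R" "a \<in> carrier R" "c \<in> carrier R"
    using * bounded_polys_carrier[OF assms(1,2)] subringE(1)[OF assms(1)] assms(3) by auto
  then have "c \<otimes> f = (c \<otimes> f') \<otimes> y \<oplus> c \<otimes> a"
    using * assms(2) by (simp add: r_distr m_assoc)
  then show ?case
    using bounded_polys_SucI[OF Suc.IH[OF *(3)] subringE(6)[OF assms(1,3) *(2)]] by simp
qed

lemma bounded_polys_uminus:
  assumes "subring A R" "y \<in> carrier R" "f \<in> bounded_polys A y n"
  shows "\<ominus> f \<in> bounded_polys A y n"
proof -
  have "f \<in> carrier R"
    using assms bounded_polys_carrier by blast
  then have "\<ominus> f = \<ominus> \<one> \<otimes> f"
    by (simp add: l_minus)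
  then show ?thesis
    using bounded_polys_smult[OF assms(1,2) subringE(5)[OF assms(1) subringE(3)[OF assms(1)]] assms(3)]
    by simp
qed

lemma bounded_polys_Suc_subset:
  assumes "subring A R" "y \<in> carrier R"
  shows "bounded_polys A y n \<subseteq> bounded_polys A y (Suc n)"
proof (induction n)
  case 0
  then show ?case using zero_in_bounded_polys[OF assms, of "Suc 0"] by auto
next
  case (Suc n)
  show ?case
  proof
    fix f assume "f \<in> bounded_polys A y (Suc n)"
    then obtain f' a where "f = f' \<otimes> y \<oplus> a" "a \<in> A" "f' \<in> bounded_polys A y n"
      by (rule bounded_polys_SucE)
    with Suc show "f \<in> bounded_polys A y (Suc (Suc n))"
      using bounded_polys_SucI by blast
  qed
qed

lemma bounded_polys_mono:
  assumes "subring A R" "y \<in> carrier R" "n \<le> m"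
  shows "bounded_polys A y n \<subseteq> bounded_polys A y m"
  using lift_Suc_mono_le[of "bounded_polys A y", OF bounded_polys_Suc_subset[OF assms(1,2)] assms(3)] .

text \<open>The recursion exposes the constant coefficient, whereas degree arguments need the other
  end. The coefficient of \<open>y [^] n\<close> comes out by induction along Horner's
  scheme.\<close>

lemma bounded_polys_lead:
  assumes "subring A R" "y \<in> carrier R" "f \<in> bounded_polys A y (Suc n)"
  shows "\<exists>g\<in>bounded_polys A y n. \<exists>c\<in>A. f = g \<oplus> c \<otimes> y [^] n"
  using assms(3)
proof (induction n arbitrary: f)
  case 0
  then obtain a where "f = \<zero> \<otimes> y \<oplus> a" "a \<in> A"
    by (auto elim: bounded_polys_SucE)
  moreover have "a \<in> carrier R"
    using \<open>a \<in> A\<close> subringE(1)[OF assms(1)] by blast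
  ultimately show ?case
    using assms(2) by (auto intro!: bexI[of _ a])
next
  case (Suc n)
  obtain f' a where *: "f = f' \<otimes> y \<oplus> a" "a \<in> A" "f' \<in> bounded_polys A y (Suc n)"
    using bounded_polys_SucE[OF Suc.prems] by metis
  obtain g c where g: "g \<in> bounded_polys A y n" "c \<in> A" "f' = g \<oplus> c \<otimes> y [^] n"
    using Suc.IH[OF *(3)] by auto
  have "g \<in> carrier R" "a \<in> carrier R" "c \<in> carrier R"
    using *(2) g(1,2) bounded_polys_carrier[OF assms(1,2)] subringE(1)[OF assms(1)] by auto
  then have "f = (g \<otimes> y \<oplus> a) \<oplus> c \<otimes> y [^] Suc n"
    using * g(3) assms(2) by (simp add: l_distr m_assoc a_ac)
  then show ?case
    using bounded_polys_SucI[OF g(1) *(2)] g(2) by blast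
qed

text \<open>Both sides arise from \<open>\<zero>\<close> by Horner steps; the union also bounds
  their number, which supplies a degree for induction.\<close>

lemma simple_extension_eq_UN:
  "simple_extension A y = (\<Union>n. bounded_polys A y n)"
proof
  show "simple_extension A y \<subseteq> (\<Union>n. bounded_polys A y n)"
  proof
    fix f assume "f \<in> simple_extension A y"
    then show "f \<in> (\<Union>n. bounded_polys A y n)"
    proof induction
      case zero
      have "\<zero> \<in> bounded_polys A y 0" by simp
      then show ?case by blast
    next
      case (lin g a)
      then obtain n where "g \<in> bounded_polys A y n" by blast
      then show ?case using bounded_polys_SucI lin by blast
    qed
  qed
  have "f \<in> bounded_polys A y n \<Longrightarrow> f \<in> simple_extension A y" for f n
    by (induction n arbitrary: f) (auto intro: simple_extension.intros elim: bounded_polys_SucE)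
  then show "(\<Union>n. bounded_polys A y n) \<subseteq> simple_extension A y"
    by blast
qed

text \<open>Homogenization: each term a z^i becomes a y^(n-i) (yz)^i. The bound \<open>Suc n\<close>
  means degree at most n, so n factors \<open>y\<close> suffice. This is the usual way to turn an
  algebraic element into an integral one.\<close>

lemma bounded_polys_rescale:
  assumes "subring A R" "y \<in> A" "z \<in> carrier R" "f \<in> bounded_polys A z (Suc n)"
  shows "y [^] n \<otimes> f \<in> bounded_polys A (y \<otimes> z) (Suc n)"
  using assms(4)
proof (induction n arbitrary: f)
  case 0
  have "y \<in> carrier R" using assms subringE(1) by blast
  moreover obtain a where a: "f = \<zero> \<otimes> z \<oplus> a" "a \<in> A"
    using 0 by (auto elim: bounded_polys_SucE)
  moreover from a have "a \<in> carrier R" using subringE(1)[OF assms(1)] by blast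
  ultimately show ?case
    using const_in_bounded_polys[OF assms(1), of "y \<otimes> z" a 0] assms(3)
    by simp
next
  case (Suc n)
  obtain g a where *: "f = g \<otimes> z \<oplus> a" "a \<in> A" "g \<in> bounded_polys A z (Suc n)"
    using bounded_polys_SucE[OF Suc.prems] by metis
  have y: "y \<in> carrier R" using assms subringE(1) by blast
  have c: "g \<in> carrier R" "a \<in> carrier R"
    using * bounded_polys_carrier[OF assms(1,3)] subringE(1)[OF assms(1)] by auto
  have "y [^] k \<in> A" for k :: nat
    using assms subringE(3,6)[OF assms(1)] by (induction k) auto
  then have "y [^] Suc n \<otimes> a \<in> A"
    using *(2) subringE(6)[OF assms(1)] by blast
  moreover have "y [^] Suc n \<otimes> f = (y [^] n \<otimes> g) \<otimes> (y \<otimes> z) \<oplus> y [^] Suc n \<otimes> a"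
    using c y assms(3) * by (simp add: r_distr m_ac)
  ultimately show ?case
    using bounded_polys_SucI[OF Suc.IH[OF *(3)]] by auto
qed

end

section \<open>Maximal subrings via Zorn's lemma\<close>

lemma (in ring) subring_chain_Union:
  assumes "C \<noteq> {}" "\<And>T. T \<in> C \<Longrightarrow> subring T R" "\<And>S T. S \<in> C \<Longrightarrow> T \<in> C \<Longrightarrow> S \<subseteq> T \<or> T \<subseteq> S"
  shows "subring (\<Union>C) R"
proof (rule subringI)
  note sub = subringE[OF assms(2)]
  show "\<Union>C \<subseteq> carrier R" using sub(1) by blast
  show "\<one> \<in> \<Union>C" using assms(1) sub(3) by blast
  show "\<ominus> h \<in> \<Union>C" if "h \<in> \<Union>C" for h
    using that sub(5) by blast
  fix h1 h2 assume "h1 \<in> \<Union>C" "h2 \<in> \<Union>C"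
  then obtain T where T: "T \<in> C" "h1 \<in> T" "h2 \<in> T"
    using assms(3) by (metis UnionE subsetD)
  then show "h1 \<otimes> h2 \<in> \<Union>C" "h1 \<oplus> h2 \<in> \<Union>C"
    using sub(6,7)[OF T] by blast+
qed

text \<open>Avoiding \<open>E\<close> passes to unions of chains, so Zorn's lemma applies. Two
  choices of \<open>E\<close> are used: the single element \<open>inv x\<close>, and the set of
  obstructions to saturation.\<close>

lemma (in ring) exists_maximal_subring_avoiding:
  assumes "subring S R" "S \<inter> E = {}"
  obtains M where "subring M R" "S \<subseteq> M" "M \<inter> E = {}"
    and "\<And>T. subring T R \<Longrightarrow> M \<subseteq> T \<Longrightarrow> T \<inter> E = {} \<Longrightarrow> T = M"
proof -
  let ?F = "{T. subring T R \<and> S \<subseteq> T \<and> T \<inter> E = {}}"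
  have "\<exists>M\<in>?F. \<forall>T\<in>?F. M \<subseteq> T \<longrightarrow> T = M"
  proof (rule subset_Zorn_nonempty)
    show "?F \<noteq> {}" using assms by blast
    fix C assume C: "C \<noteq> {}" "subset.chain ?F C"
    then have "subring (\<Union>C) R"
      by (intro subring_chain_Union) (auto simp: subset_chain_def)
    moreover have "S \<subseteq> T" "T \<inter> E = {}" if "T \<in> C" for T
      using C(2) that by (auto simp: subset_chain_def)
    ultimately show "\<Union>C \<in> ?F" using C(1) by blast
  qed
  then obtain M where M: "M \<in> ?F" "\<forall>T\<in>?F. M \<subseteq> T \<longrightarrow> T = M"
    by (rule bexE)
  have "T = M" if T: "subring T R" "M \<subseteq> T" "T \<inter> E = {}" for T
  proof -
    have "T \<in> ?F" using T M(1) by (simp, blast)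
    then show ?thesis using M(2)[rule_format, of T] T by simp
  qed
  moreover have "subring M R" "S \<subseteq> M" "M \<inter> E = {}"
    using M(1) by simp_all
  ultimately show thesis
    by (intro that)
qed

text \<open>A subring that is maximal among those containing \<open>S\<close> and omitting
  \<open>inv x\<close> is a maximal subring: anything larger contains all powers of
  \<open>inv x\<close>, and these recover every \<open>z\<close> from
  \<open>x [^] k \<otimes> z\<close>.\<close>

lemma (in cring) maximal_subring_if_localization:
  assumes x: "x \<in> Units R" and S: "subring S R" "inv x \<notin> S"
    and loc: "\<And>z. z \<in> carrier R \<Longrightarrow> \<exists>k::nat. x [^] k \<otimes> z \<in> S"
  shows "submaximal R"
proof -
  have "S \<inter> {inv x} = {}" using S(2) by simp
  then obtain M where M: "subring M R" "S \<subseteq> M" "M \<inter> {inv x} = {}"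
    and max: "\<And>T. subring T R \<Longrightarrow> M \<subseteq> T \<Longrightarrow> T \<inter> {inv x} = {} \<Longrightarrow> T = M"
    using exists_maximal_subring_avoiding[OF S(1)] by metis
  have "T = carrier R" if T: "subring T R" "M \<subseteq> T" "T \<noteq> M" for T
  proof
    show "T \<subseteq> carrier R" using T subringE(1) by blast
    have "inv x \<in> T" using max T by blast
    then have pow: "inv x [^] k \<in> T" for k :: nat
      using subringE(3,6)[OF T(1)] by (induction k) auto
    show "carrier R \<subseteq> T"
    proof
      fix z assume z: "z \<in> carrier R"
      then obtain k :: nat where "x [^] k \<otimes> z \<in> T" using loc M T by blast
      then have "inv x [^] k \<otimes> (x [^] k \<otimes> z) \<in> T" using subringE(6)[OF T(1)] pow by blast
      moreover have "inv x [^] k \<otimes> (x [^] k \<otimes> z) = z"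
        using x z by (simp add: m_assoc[symmetric] nat_pow_distrib[symmetric] Units_closed)
      ultimately show "z \<in> T" by simp
    qed
  qed
  moreover have "M \<noteq> carrier R" using M x by auto
  ultimately show ?thesis
    unfolding submaximal_def maximal_subring_def using M(1)
    by (intro exI[of _ M] conjI allI impI) auto
qed

section \<open>Subrings with a discrete uniformizer\<close>

text \<open>The third clause is primality of xA without properness; if \<open>\<one>\<close> is
  nonzero, properness follows from the last clause at \<open>\<one>\<close>. In a domain with
  \<open>x\<close> nonzero, the localization of \<open>A\<close> at xA is a discrete valuation ring
  with uniformizer \<open>x\<close>.\<close>

definition (in ring) discrete_at :: "'a \<Rightarrow> 'a set \<Rightarrow> bool" where
  "discrete_at x A \<longleftrightarrow> subring A R \<and> x \<in> A \<and>
    (\<forall>a\<in>A. \<forall>b\<in>A. \<forall>c\<in>A. a \<otimes> b = x \<otimes> c \<longrightarrow> (\<exists>d\<in>A. a = x \<otimes> d \<or> b = x \<otimes> d)) \<and>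
    (\<forall>a\<in>A - {\<zero>}. \<exists>k::nat. \<forall>b\<in>A. a \<noteq> x [^] k \<otimes> b)"

text \<open>For cancellable \<open>x\<close> this says \<open>xB \<inter> A = xA\<close>. Ordering subrings by this relation instead of
  inclusion keeps \<open>\<Inter>\<^sub>k x\<^sup>kA = 0\<close> under unions of chains.\<close>

definition (in ring) saturated :: "'a \<Rightarrow> 'a set \<Rightarrow> 'a set \<Rightarrow> bool" where
  "saturated x A B \<longleftrightarrow> A \<subseteq> B \<and> (\<forall>b\<in>B. x \<otimes> b \<in> A \<longrightarrow> b \<in> A)"

text \<open>Transcendence of \<open>y\<close> over \<open>A\<close>, in a form suited to induction along \<^const>\<open>ring.simple_extension\<close>.\<close>

definition (in ring) free_over :: "'a set \<Rightarrow> 'a \<Rightarrow> bool" where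
  "free_over A y \<longleftrightarrow>
    (\<forall>f\<in>simple_extension A y. \<forall>a\<in>A. f \<otimes> y \<oplus> a = \<zero> \<longrightarrow> f = \<zero> \<and> a = \<zero>)"

lemma (in ring) discrete_atD:
  assumes "discrete_at x A"
  shows "subring A R" "x \<in> A"
    and "\<lbrakk>a \<in> A; b \<in> A; c \<in> A; a \<otimes> b = x \<otimes> c\<rbrakk> \<Longrightarrow> \<exists>d\<in>A. a = x \<otimes> d \<or> b = x \<otimes> d"
    and "\<lbrakk>a \<in> A; a \<noteq> \<zero>\<rbrakk> \<Longrightarrow> \<exists>k::nat. \<forall>b\<in>A. a \<noteq> x [^] k \<otimes> b"
  using assms unfolding discrete_at_def by blast+

lemma (in ring) subring_pow_closed:
  assumes "subring A R" "x \<in> A"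
  shows "x [^] (k::nat) \<in> A"
  using subringE(3,6)[OF assms(1)] assms(2) by (induction k) auto

lemma (in cring) saturated_pow:
  assumes "saturated x A B" "subring B R" "x \<in> B" "b \<in> B" "x [^] (k::nat) \<otimes> b \<in> A"
  shows "b \<in> A"
  using assms(4,5)
proof (induction k arbitrary: b)
  case 0
  then show ?case using subringE(1)[OF assms(2)] by auto
next
  case (Suc k)
  have c: "x \<in> carrier R" "b \<in> carrier R"
    using subringE(1)[OF assms(2)] assms(3) Suc.prems(1) by auto
  have "x [^] k \<otimes> (x \<otimes> b) \<in> A"
    using Suc.prems(2) c by (simp add: m_assoc)
  moreover have "x \<otimes> b \<in> B"
    using subringE(6)[OF assms(2,3) Suc.prems(1)] .
  ultimately have "x \<otimes> b \<in> A"
    using Suc.IH by blast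
  then show ?case
    using assms(1) Suc.prems(1) unfolding saturated_def by blast
qed

text \<open>Primality involves three elements at a time, which lie in a common member of the chain.
  For separation, an exponent that works for \<open>a\<close> in \<open>A\<close> works in the
  union: saturation pulls any cofactor of a power of \<open>x\<close> back into
  \<open>A\<close>.\<close>

lemma (in domain) discrete_at_subset_Union:
  assumes C: "C \<noteq> {}" "\<And>A. A \<in> C \<Longrightarrow> discrete_at x A"
    and chain: "\<And>A B. A \<in> C \<Longrightarrow> B \<in> C \<Longrightarrow> saturated x A B \<or> saturated x B A"
  shows "discrete_at x (\<Union>C)" and "\<And>A. A \<in> C \<Longrightarrow> saturated x A (\<Union>C)"
proof -
  have sub: "subring A R" "x \<in> A" if "A \<in> C" for A
    using C(2)[OF that] unfolding discrete_at_def by simp_all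
  have incl: "A \<subseteq> B \<or> B \<subseteq> A" if "A \<in> C" "B \<in> C" for A B
    using chain[OF that] unfolding saturated_def by (elim disjE conjE) simp_all
  \<comment> \<open>The member containing \<open>b\<close> can be chosen above \<open>A\<close>;
    using this repeatedly gathers several elements in one member.\<close>
  have up: "\<exists>B\<in>C. b \<in> B \<and> saturated x A B" if A: "A \<in> C" and b: "b \<in> \<Union>C" for A b
  proof -
    obtain B where B: "B \<in> C" "b \<in> B" using b by blast
    have refl: "saturated x A A" unfolding saturated_def by simp
    show ?thesis
      using chain[OF A B(1)]
    proof
      assume "saturated x B A"
      then have "b \<in> A" using B(2) unfolding saturated_def by (elim conjE) (rule subsetD)
      then show ?thesis using refl A by (intro bexI[of _ A] conjI)
    qed (use B in \<open>intro bexI[of _ B] conjI\<close>)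
  qed
  show sat: "saturated x A (\<Union>C)" if "A \<in> C" for A
    unfolding saturated_def
  proof (intro conjI ballI impI)
    show "A \<subseteq> \<Union>C" using that by (rule Union_upper)
    fix b assume b: "b \<in> \<Union>C" "x \<otimes> b \<in> A"
    have "\<exists>B\<in>C. b \<in> B \<and> saturated x A B" using up[OF that b(1)] .
    then obtain B where "B \<in> C" "b \<in> B" "saturated x A B" by blast
    then show "b \<in> A" using b(2) unfolding saturated_def by simp
  qed
  have subU: "subring (\<Union>C) R"
    using subring_chain_Union[OF C(1) sub(1) incl] .
  obtain A0 where A0: "A0 \<in> C" using C(1) by auto
  have xU: "x \<in> \<Union>C" using sub(2)[OF A0] A0 by (rule UnionI[rotated])
  show "discrete_at x (\<Union>C)"
    unfolding discrete_at_def
  proof (intro conjI ballI impI)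
    fix a b c assume abc: "a \<in> \<Union>C" "b \<in> \<Union>C" "c \<in> \<Union>C" "a \<otimes> b = x \<otimes> c"
    obtain A where A: "A \<in> C" "a \<in> A" using abc(1) by blast
    obtain B where B: "B \<in> C" "b \<in> B" "saturated x A B" using up[OF A(1) abc(2)] by blast
    obtain D where D: "D \<in> C" "c \<in> D" "saturated x B D" using up[OF B(1) abc(3)] by blast
    have "b \<in> D" using B(2) D(3) unfolding saturated_def by (elim conjE) (rule subsetD)
    moreover have "a \<in> D" using A(2) B(3) D(3) unfolding saturated_def by (elim conjE) (blast dest: subsetD)
    ultimately obtain d where d: "d \<in> D" "a = x \<otimes> d \<or> b = x \<otimes> d"
      using C(2)[OF D(1)] D(2) abc(4) unfolding discrete_at_def by blast
    then show "\<exists>d\<in>\<Union>C. a = x \<otimes> d \<or> b = x \<otimes> d"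
      using D(1) by (intro bexI[of _ d] UnionI[of D])
  next
    fix a assume a: "a \<in> \<Union>C - {\<zero>}"
    then obtain A where A: "A \<in> C" "a \<in> A" "a \<noteq> \<zero>" by blast
    have "\<exists>k::nat. \<forall>b\<in>A. a \<noteq> x [^] k \<otimes> b"
      using discrete_atD(4)[OF C(2)[OF A(1)] A(2,3)] .
    then obtain k :: nat where k: "\<And>b. b \<in> A \<Longrightarrow> a \<noteq> x [^] k \<otimes> b"
      by blast
    have "a \<noteq> x [^] k \<otimes> b" if b: "b \<in> \<Union>C" for b
    proof
      assume eq: "a = x [^] k \<otimes> b"
      then have "b \<in> A"
        using saturated_pow[OF sat[OF A(1)] subU xU b] A(2) by simp
      then show False using k eq by blast
    qed
    then show "\<exists>k::nat. \<forall>b\<in>\<Union>C. a \<noteq> x [^] k \<otimes> b"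
      by (intro exI[of _ k] ballI)
  qed (rule subU, rule xU)
qed

text \<open>Zorn's lemma for the order \<open>saturated x\<close> rather than inclusion, hence its
  version for an arbitrary partial order. The empty chain is bounded by \<open>A\<close>.\<close>

lemma (in domain) exists_maximal_discrete_at:
  assumes "discrete_at x A"
  obtains M where "discrete_at x M" "saturated x A M"
    and "\<And>B. discrete_at x B \<Longrightarrow> saturated x M B \<Longrightarrow> B = M"
proof -
  have trans: "saturated x A C" if "saturated x A B" "saturated x B C" for A B C
    using that unfolding saturated_def by auto
  have antisym: "A = B" if "saturated x A B" "saturated x B A" for A B
    using that unfolding saturated_def by auto
  have refl: "saturated x A A" for A
    unfolding saturated_def by auto
  define F where "F = {B. discrete_at x B \<and> saturated x A B}"
  have "A \<in> F" using assms refl by (simp add: F_def)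
  have "\<exists>M\<in>F. \<forall>B\<in>F. saturated x M B \<longrightarrow> B = M"
  proof (rule predicate_Zorn)
    show "partial_order_on F (relation_of (saturated x) F)"
      by (rule partial_order_on_relation_ofI) (use refl trans antisym in metis)+
    fix C assume C: "C \<in> Chains (relation_of (saturated x) F)"
    then have CF: "B \<in> F" if "B \<in> C" for B
      using that by (auto simp: Chains_def relation_of_def)
    have comp: "saturated x B D \<or> saturated x D B" if "B \<in> C" "D \<in> C" for B D
      using C that by (auto simp: Chains_def relation_of_def)
    show "\<exists>u\<in>F. \<forall>B\<in>C. saturated x B u"
    proof (cases "C = {}")
      case True
      then show ?thesis using \<open>A \<in> F\<close> by auto
    next
      case False
      have dis: "\<And>B. B \<in> C \<Longrightarrow> discrete_at x B" using CF by (simp add: F_def)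
      have U: "discrete_at x (\<Union>C)" "\<And>B. B \<in> C \<Longrightarrow> saturated x B (\<Union>C)"
        using discrete_at_subset_Union[OF False dis comp] by blast+
      obtain B where B: "B \<in> C" using False by auto
      have "saturated x A B" using CF[OF B] by (simp add: F_def)
      then have "\<Union>C \<in> F"
        using U(1) trans[OF _ U(2)[OF B]] by (simp add: F_def)
      then show ?thesis using U(2) by (intro bexI[of _ "\<Union>C"] ballI)
    qed
  qed
  then obtain M where M: "M \<in> F" and max: "\<forall>B\<in>F. saturated x M B \<longrightarrow> B = M" by (rule bexE)
  show thesis
  proof (rule that)
    show "discrete_at x M" "saturated x A M" using M by (simp_all add: F_def)
    then show "B = M" if "discrete_at x B" "saturated x M B" for B
      using that max trans by (simp add: F_def)
  qed
qed

lemma (in domain) simple_extension_cases: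
  assumes "f \<in> simple_extension A y" "y \<in> carrier R" "subring A R"
  obtains g a where "g \<in> simple_extension A y" "a \<in> A" "f = g \<otimes> y \<oplus> a"
  using assms(1)
proof cases
  case zero
  then show ?thesis using that[of \<zero> \<zero>] assms subringE(2)[OF assms(3)] by simp
qed (use that in blast)

lemma (in domain) free_over_decomp_unique:
  assumes A: "subring A R" and y: "y \<in> carrier R" "free_over A y"
    and mem: "f \<in> simple_extension A y" "g \<in> simple_extension A y" "a \<in> A" "b \<in> A"
    and eq: "f \<otimes> y \<oplus> a = g \<otimes> y \<oplus> b"
  shows "f = g" "a = b"
proof -
  note E = simple_extension_is_subring[OF A y(1)]
  have c: "f \<in> carrier R" "g \<in> carrier R" "a \<in> carrier R" "b \<in> carrier R"
    using mem subringE(1)[OF E] subringE(1)[OF A] by auto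
  have "f \<ominus> g \<in> simple_extension A y" "a \<ominus> b \<in> A"
    using mem subringE(5,7)[OF E] subringE(5,7)[OF A] unfolding a_minus_def by auto
  moreover have "(f \<ominus> g) \<otimes> y \<oplus> (a \<ominus> b) = (f \<otimes> y \<oplus> a) \<ominus> (g \<otimes> y \<oplus> b)"
    using c y by algebra
  then have "(f \<ominus> g) \<otimes> y \<oplus> (a \<ominus> b) = \<zero>"
    using eq c y by simp
  ultimately have "f \<ominus> g = \<zero>" "a \<ominus> b = \<zero>"
    using y(2) unfolding free_over_def by auto
  then show "f = g" "a = b" using c by auto
qed

text \<open>Multiplication by a constant acts coefficientwise, so uniqueness of the decomposition
  lets divisibility by \<open>x\<close> be read off coefficient by coefficient.\<close>

lemma (in domain) free_over_divisible:
  assumes A: "subring A R" and y: "y \<in> carrier R" "free_over A y"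
    and mem: "f \<in> simple_extension A y" "a \<in> A" "x \<in> A" "d \<in> simple_extension A y"
    and eq: "f \<otimes> y \<oplus> a = x \<otimes> d"
  obtains f' a' where "f' \<in> simple_extension A y" "a' \<in> A" "d = f' \<otimes> y \<oplus> a'"
    "f = x \<otimes> f'" "a = x \<otimes> a'"
proof -
  note E = simple_extension_is_subring[OF A y(1)]
  have AE: "A \<subseteq> simple_extension A y"
    using simple_extension_incl[OF subringE(1)[OF A] y(1)] .
  obtain f' a' where d: "f' \<in> simple_extension A y" "a' \<in> A" "d = f' \<otimes> y \<oplus> a'"
    using simple_extension_cases[OF mem(4) y(1) A] by metis
  have c: "f' \<in> carrier R" "a' \<in> carrier R" "x \<in> carrier R"
    using mem d subringE(1)[OF E] subringE(1)[OF A] by auto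
  have "x \<otimes> f' \<in> simple_extension A y" "x \<otimes> a' \<in> A"
    using d mem AE subringE(6)[OF E] subringE(6)[OF A] by auto
  moreover have "f \<otimes> y \<oplus> a = (x \<otimes> f') \<otimes> y \<oplus> x \<otimes> a'"
    using eq c y d(3) by (simp add: r_distr m_assoc)
  ultimately have "f = x \<otimes> f'" "a = x \<otimes> a'"
    using free_over_decomp_unique[OF A y mem(1) _ mem(2)] by metis+
  then show thesis using that d by blast
qed

section \<open>Transcendental extensions\<close>

text \<open>Gauss's lemma, by nested induction on the Horner forms of both factors. The constant
  term of the product decides which factor is shortened; the inner statement is quantified so that
  the outer hypothesis applies to any second factor.\<close>

lemma (in domain) free_over_prime:
  assumes A: "discrete_at x A" and y: "y \<in> carrier R" "free_over A y"
    and mem: "f \<in> simple_extension A y" "g \<in> simple_extension A y" "h \<in> simple_extension A y"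
    and eq: "f \<otimes> g = x \<otimes> h"
  shows "\<exists>d\<in>simple_extension A y. f = x \<otimes> d \<or> g = x \<otimes> d"
proof -
  note sub = discrete_atD(1)[OF A] and xA = discrete_atD(2)[OF A] and prime = discrete_atD(3)[OF A]
  let ?E = "simple_extension A y"
  note E = simple_extension_is_subring[OF sub y(1)]
  have AE: "A \<subseteq> ?E"
    using simple_extension_incl[OF subringE(1)[OF sub] y(1)] .
  have yE: "y \<in> ?E" using simple_extension_mem[OF sub y(1)] .
  note Ecl = subringE(5-7)[OF E] subringE(2)[OF E]
  note Acl = subringE(5-7)[OF sub]
  have Ec: "e \<in> carrier R" if "e \<in> ?E" for e using that subringE(1)[OF E] by blast
  have AE': "e \<in> ?E" if "e \<in> A" for e using that AE by blast
  have x: "x \<in> carrier R" "x \<in> ?E" using xA AE Ec by auto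
  have zero_ok: "\<zero> = x \<otimes> \<zero>" using x by simp
  have "\<forall>g h. g \<in> ?E \<longrightarrow> h \<in> ?E \<longrightarrow> f \<otimes> g = x \<otimes> h \<longrightarrow> (\<exists>d\<in>?E. f = x \<otimes> d \<or> g = x \<otimes> d)"
    using mem(1)
  proof (induction rule: simple_extension.induct)
    case zero
    then show ?case using zero_ok Ecl(4) by blast
  next
    case (lin f a)
    define F where "F = f \<otimes> y \<oplus> a"
    have FE: "F \<in> ?E" unfolding F_def using lin(1,2) simple_extension.lin by blast
    have "\<forall>h. h \<in> ?E \<longrightarrow> F \<otimes> g = x \<otimes> h \<longrightarrow> (\<exists>d\<in>?E. F = x \<otimes> d \<or> g = x \<otimes> d)"
      if "g \<in> ?E" for g
      using that
    proof (induction rule: simple_extension.induct)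
      case zero
      then show ?case using zero_ok Ecl(4) by blast
    next
      case (lin g b)
      define G where "G = g \<otimes> y \<oplus> b"
      have GE: "G \<in> ?E" unfolding G_def using lin(1,2) simple_extension.lin by blast
      have c: "f \<in> carrier R" "a \<in> carrier R" "g \<in> carrier R" "b \<in> carrier R"
        using lin(1,2) \<open>f \<in> ?E\<close> \<open>a \<in> A\<close> Ec AE by auto
      show ?case
        unfolding G_def[symmetric]
      proof (intro allI impI)
        fix h assume h: "h \<in> ?E" "F \<otimes> G = x \<otimes> h"
        \<comment> \<open>The product FG without its constant term \<open>a \<otimes> b\<close>,
          divided by \<open>y\<close>; both parts are then divisible by \<open>x\<close>.\<close>
        define s where "s = f \<otimes> g \<otimes> y \<oplus> f \<otimes> b \<oplus> a \<otimes> g"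
        have sE: "s \<in> ?E" unfolding s_def
          using lin(1,2) \<open>f \<in> ?E\<close> \<open>a \<in> A\<close> AE' yE by (intro Ecl(2,3)) auto
        have ab: "a \<otimes> b \<in> A" using lin(2) \<open>a \<in> A\<close> Acl by blast
        have "s \<otimes> y \<oplus> a \<otimes> b = F \<otimes> G"
          unfolding s_def F_def G_def using c y(1) by algebra
        with h have "s \<otimes> y \<oplus> a \<otimes> b = x \<otimes> h" by simp
        from free_over_divisible[OF sub y sE ab xA h(1) this]
        obtain s' c' where s': "s' \<in> ?E" "c' \<in> A" "s = x \<otimes> s'" "a \<otimes> b = x \<otimes> c'" by metis
        then obtain d where d: "d \<in> A" "a = x \<otimes> d \<or> b = x \<otimes> d"
          using prime[OF \<open>a \<in> A\<close> lin(2)] by blast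
        note cc = c y(1) x(1) Ec[OF s'(1)] Ec[OF AE'[OF d(1)]]
        show "\<exists>d\<in>?E. F = x \<otimes> d \<or> G = x \<otimes> d"
          using d(2)
        proof
          assume a: "a = x \<otimes> d"
          \<comment> \<open>Since \<open>x\<close> divides \<open>s\<close> and \<open>a\<close>, it
            divides the product of \<open>G\<close> with the shorter factor \<open>f\<close>, to
            which the outer induction hypothesis applies.\<close>
          have "f \<otimes> G = x \<otimes> (s' \<ominus> d \<otimes> g)"
          proof -
            have "f \<otimes> G = s \<ominus> a \<otimes> g"
              unfolding G_def s_def using cc by algebra
            also have "\<dots> = x \<otimes> (s' \<ominus> d \<otimes> g)"
              unfolding s'(3) a using cc by algebra
            finally show ?thesis .
          qed
          moreover have "s' \<ominus> d \<otimes> g \<in> ?E"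
            unfolding a_minus_def using s'(1) d(1) lin(1) AE' by (intro Ecl(1-3))
          ultimately obtain e where e: "e \<in> ?E" "f = x \<otimes> e \<or> G = x \<otimes> e"
            using \<open>\<forall>g h. g \<in> ?E \<longrightarrow> h \<in> ?E \<longrightarrow> f \<otimes> g = x \<otimes> h \<longrightarrow> (\<exists>d\<in>?E. f = x \<otimes> d \<or> g = x \<otimes> d)\<close> GE by blast
          from e(2) show ?thesis
          proof
            assume f: "f = x \<otimes> e"
            have "F = x \<otimes> (e \<otimes> y \<oplus> d)"
              unfolding F_def f a using cc Ec[OF e(1)] by algebra
            then show ?thesis using simple_extension.lin[OF e(1) d(1)] by blast
          qed (use e(1) in blast)
        next
          assume b: "b = x \<otimes> d"
          \<comment> \<open>The mirror image: now \<open>G\<close> is shortened to \<open>g\<close>,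
            and the inner induction hypothesis applies.\<close>
          have "F \<otimes> g = x \<otimes> (s' \<ominus> f \<otimes> d)"
          proof -
            have "F \<otimes> g = s \<ominus> f \<otimes> b"
              unfolding F_def s_def using cc by algebra
            also have "\<dots> = x \<otimes> (s' \<ominus> f \<otimes> d)"
              unfolding s'(3) b using cc by algebra
            finally show ?thesis .
          qed
          moreover have "s' \<ominus> f \<otimes> d \<in> ?E"
            unfolding a_minus_def using s'(1) d(1) \<open>f \<in> ?E\<close> AE' by (intro Ecl(1-3))
          ultimately obtain e where e: "e \<in> ?E" "F = x \<otimes> e \<or> g = x \<otimes> e"
            using lin(3) by blast
          from e(2) show ?thesis
          proof
            assume g: "g = x \<otimes> e"
            have "G = x \<otimes> (e \<otimes> y \<oplus> d)"
              unfolding G_def g b using cc Ec[OF e(1)] by algebra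
            then show ?thesis using simple_extension.lin[OF e(1) d(1)] by blast
          qed (use e(1) in blast)
        qed
      qed
    qed
    then show ?case unfolding F_def by blast
  qed
  then show ?thesis using mem eq by blast
qed

text \<open>Divisibility is coefficientwise, so an exponent that is too large for one nonzero
  coefficient is too large for the whole expression.\<close>

lemma (in domain) free_over_separated:
  assumes A: "discrete_at x A" and y: "y \<in> carrier R" "free_over A y"
    and f: "f \<in> simple_extension A y" "f \<noteq> \<zero>"
  shows "\<exists>k::nat. \<forall>b\<in>simple_extension A y. f \<noteq> x [^] k \<otimes> b"
  using f
proof (induction rule: simple_extension.induct)
  case (lin f a)
  have xk: "x [^] k \<in> A" for k :: nat using subring_pow_closed[OF discrete_atD(1,2)[OF A]] .
  have split: "\<exists>d'\<in>simple_extension A y. \<exists>c\<in>A. f = x [^] k \<otimes> d' \<and> a = x [^] k \<otimes> c"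
    if "d \<in> simple_extension A y" "f \<otimes> y \<oplus> a = x [^] k \<otimes> d" for k :: nat and d
    using free_over_divisible[OF discrete_atD(1)[OF A] y lin(1,2) xk that] by metis
  show ?case
  proof (cases "a = \<zero>")
    case False
    then obtain k :: nat where "\<forall>b\<in>A. a \<noteq> x [^] k \<otimes> b" using discrete_atD(4)[OF A lin(2)] by blast
    then show ?thesis using split by blast
  next
    case True
    have "f \<noteq> \<zero>" using True lin(4) y(1) by auto
    then obtain k :: nat where "\<forall>b\<in>simple_extension A y. f \<noteq> x [^] k \<otimes> b" using lin(3) by blast
    then show ?thesis using split by blast
  qed
qed simp

text \<open>This makes transcendental extensions admissible in the Zorn argument, so that over a
  maximal member every element is algebraic.\<close>

lemma (in domain) discrete_at_free_extension:
  assumes A: "discrete_at x A" "x \<noteq> \<zero>" and y: "y \<in> carrier R" "free_over A y"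
  shows "discrete_at x (simple_extension A y)" "saturated x A (simple_extension A y)"
proof -
  note sub = discrete_atD(1)[OF A(1)] and xA = discrete_atD(2)[OF A(1)]
  let ?E = "simple_extension A y"
  note E = simple_extension_is_subring[OF sub y(1)]
  have AE: "A \<subseteq> ?E"
    using simple_extension_incl[OF subringE(1)[OF sub] y(1)] .
  show "discrete_at x ?E"
    unfolding discrete_at_def
    using E xA AE free_over_prime[OF A(1) y] free_over_separated[OF A(1) y] by blast
  show "saturated x A ?E"
    unfolding saturated_def
  proof (intro conjI ballI impI)
    fix b assume b: "b \<in> ?E" "x \<otimes> b \<in> A"
    have c: "x \<in> carrier R" "b \<in> carrier R" "x \<otimes> b \<in> carrier R"
      using b xA subringE(1)[OF E] AE by auto
    \<comment> \<open>Reading \<open>x \<otimes> b\<close> as a bare constant term makes it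
      \<open>x\<close> times an element of \<open>A\<close>, and cancelling \<open>x\<close>
      identifies that element with \<open>b\<close>.\<close>
    have "\<zero> \<otimes> y \<oplus> x \<otimes> b = x \<otimes> b"
      using c y(1) by simp
    from free_over_divisible[OF sub y subringE(2)[OF E] b(2) xA b(1) this]
    obtain f' a' where "a' \<in> A" "x \<otimes> b = x \<otimes> a'" by metis
    then show "b \<in> A"
      using m_lcancel[OF A(2) c(1,2), of a'] subringE(1)[OF sub] by auto
  qed (rule AE)
qed

text \<open>In a nontrivial relation the value \<open>f\<close> is nonzero, so its expression has a
  nonzero coefficient. The highest one, shifted by one degree through the factor \<open>y\<close>,
  leads the relation.\<close>

lemma (in domain) not_free_over_lead:
  assumes A: "subring A R" and y: "y \<in> carrier R" "\<not> free_over A y"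
  obtains n c where "c \<in> A" "c \<noteq> \<zero>" "c \<otimes> y [^] (n::nat) \<in> bounded_polys A y n"
proof -
  \<comment> \<open>The induction discards vanishing top coefficients until a nonzero one
    appears.\<close>
  have lead: "\<exists>n c g. c \<in> A \<and> c \<noteq> \<zero> \<and> g \<in> bounded_polys A y n \<and> f = g \<oplus> c \<otimes> y [^] n"
    if "f \<in> bounded_polys A y m" "f \<noteq> \<zero>" for f m
    using that
  proof (induction m)
    case (Suc m)
    obtain g c where *: "g \<in> bounded_polys A y m" "c \<in> A" "f = g \<oplus> c \<otimes> y [^] m"
      using bounded_polys_lead[OF A y(1) Suc.prems(1)] by blast
    show ?case
    proof (cases "c = \<zero>")
      case True
      have "g \<in> carrier R" using * bounded_polys_carrier[OF A y(1)] by blast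
      with True * have "f = g" using y(1) by simp
      then show ?thesis using Suc * by blast
    qed (use * in blast)
  qed simp
  obtain f a where fa: "f \<in> simple_extension A y" "a \<in> A" "f \<otimes> y \<oplus> a = \<zero>" "f \<noteq> \<zero> \<or> a \<noteq> \<zero>"
    using y(2) unfolding free_over_def by blast
  have c: "f \<in> carrier R" "a \<in> carrier R"
    using fa subringE(1)[OF simple_extension_is_subring[OF A y(1)]] subringE(1)[OF A] by auto
  show thesis
  proof (cases "y = \<zero>")
    case True
    have "\<one> \<otimes> y [^] (1::nat) \<in> bounded_polys A y 1"
      using True const_in_bounded_polys[OF A y(1) subringE(2)[OF A], of 0] by simp
    then show thesis using that[of \<one> 1] subringE(3)[OF A] by simp
  next
    case False
    have "f \<noteq> \<zero>"
      using fa c y(1) by auto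
    then obtain n k g where *: "k \<in> A" "k \<noteq> \<zero>" "g \<in> bounded_polys A y n" "f = g \<oplus> k \<otimes> y [^] (n::nat)"
      using fa(1) lead unfolding simple_extension_eq_UN by blast
    have cc: "g \<in> carrier R" "k \<in> carrier R"
      using * bounded_polys_carrier[OF A y(1)] subringE(1)[OF A] by auto
    have "f \<otimes> y \<oplus> a = (g \<otimes> y \<oplus> a) \<oplus> k \<otimes> y [^] Suc n"
      unfolding *(4) using cc c y(1) by (simp add: l_distr m_assoc a_ac)
    then have "k \<otimes> y [^] Suc n = \<ominus> (g \<otimes> y \<oplus> a)"
      using fa(3) cc c y(1) by (metis a_closed add.inv_comm m_closed minus_equality nat_pow_closed)
    then have "k \<otimes> y [^] Suc n \<in> bounded_polys A y (Suc n)"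
      using bounded_polys_uminus[OF A y(1) bounded_polys_SucI[OF *(3) fa(2)]] by simp
    then show thesis using that * by blast
  qed
qed

section \<open>Algebraic elements\<close>

lemma (in cring) bounded_polys_subset:
  assumes "A \<subseteq> B"
  shows "bounded_polys A y n \<subseteq> bounded_polys B y n"
proof (induction n)
  case (Suc n)
  show ?case
  proof
    fix f assume "f \<in> bounded_polys A y (Suc n)"
    then obtain g a where "g \<in> bounded_polys A y n" "a \<in> A" "f = g \<otimes> y \<oplus> a"
      by (rule bounded_polys_SucE)
    then show "f \<in> bounded_polys B y (Suc n)"
      using Suc assms bounded_polys_SucI by blast
  qed
qed simp

text \<open>An elementary replacement for lying over. The set \<open>N\<close> stands for elements of \<open>S\<close> to be thought of
  as units, \<open>u\<close> gives an integral equation for \<open>w\<close>, and \<open>b\<close> says that \<open>x\<close> becomes invertible in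
  \<open>S[w]\<close>. Each of the two relations can be used to lower the degree of the other.\<close>

lemma (in domain) bounded_polys_descent:
  assumes S: "subring S R" "x \<in> S" and w: "w \<in> carrier R" "w \<noteq> \<zero>"
    and N: "N \<subseteq> S" "\<zero> \<notin> N" "\<And>u v. u \<in> N \<Longrightarrow> v \<in> N \<Longrightarrow> u \<otimes> v \<in> N"
      "\<And>u s. u \<in> N \<Longrightarrow> s \<in> S \<Longrightarrow> u \<oplus> x \<otimes> s \<in> N"
    and u: "u \<in> N" "u \<otimes> w [^] (n::nat) \<in> bounded_polys S w n"
    and b: "b \<in> N" "b = x \<otimes> (g \<otimes> w)" "g \<in> bounded_polys S w m"
  shows False
  using u b
proof (induction "n + m" arbitrary: n m u b g rule: less_induct)
  case less
  note P = bounded_polys_carrier[OF S(1) w(1), THEN subsetD]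
  have Sc: "s \<in> carrier R" if "s \<in> S" for s using that subringE(1)[OF S(1)] by blast
  note Scl = subringE(5-7)[OF S(1)]
  have uc: "u \<in> carrier R" "b \<in> carrier R" "x \<in> carrier R" "g \<in> carrier R" "u \<in> S" "b \<in> S"
    using less.prems N(1) S(2) Sc P by auto
  show False
  proof (cases n)
    \<comment> \<open>The strict degree bound leaves only \<open>\<zero>\<close> here, so
      \<open>u\<close> would be zero, which \<open>N\<close> excludes.\<close>
    case 0
    then show False using less.prems(1,2) N(2) uc by simp
  next
    case (Suc n')
    obtain h s where h: "h \<in> bounded_polys S w n'" "s \<in> S" "u \<otimes> w [^] n = h \<otimes> w \<oplus> s"
      using bounded_polys_SucE less.prems(2) unfolding Suc by metis
    have hc: "h \<in> carrier R" "s \<in> carrier R" using h P Sc by auto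
    show False
    proof (cases "m \<le> n")
      \<comment> \<open>Lowering \<open>n\<close>: multiply the equation for \<open>w\<close> by
        \<open>b\<close>, replace \<open>b\<close> next to \<open>s\<close> by
        \<open>x \<otimes> (g \<otimes> w)\<close>, and cancel \<open>w\<close>. Moving the top term
        of \<open>g\<close> to the left changes the leading coefficient only by a multiple of
        \<open>x\<close>, so it stays in \<open>N\<close>.\<close>
      case True
      have "g \<in> bounded_polys S w (Suc n')"
        using bounded_polys_mono[OF S(1) w(1) True] less.prems(5) unfolding Suc by blast
      then obtain g' c where g': "g' \<in> bounded_polys S w n'" "c \<in> S" "g = g' \<oplus> c \<otimes> w [^] n'"
        using bounded_polys_lead[OF S(1) w(1)] by blast
      have gc: "g' \<in> carrier R" "c \<in> carrier R" using g' P Sc by auto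
      have wn: "w [^] n = w [^] n' \<otimes> w" "w [^] n' \<in> carrier R" using Suc w(1) by simp_all
      have "(b \<otimes> u \<otimes> w [^] n') \<otimes> w = b \<otimes> (u \<otimes> w [^] n)"
        using uc w(1) wn by (simp add: m_assoc)
      also have "\<dots> = b \<otimes> (h \<otimes> w) \<oplus> s \<otimes> b"
        unfolding h(3) using uc hc w(1) by algebra
      also have "\<dots> = b \<otimes> (h \<otimes> w) \<oplus> s \<otimes> (x \<otimes> (g \<otimes> w))"
        using less.prems(4) by simp
      also have "\<dots> = (b \<otimes> h \<oplus> s \<otimes> x \<otimes> g) \<otimes> w"
        using uc hc w(1) by algebra
      finally have "b \<otimes> u \<otimes> w [^] n' = b \<otimes> h \<oplus> s \<otimes> x \<otimes> g"
        using m_rcancel[OF w(2,1)] uc hc wn(2) by simp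
      then have "(b \<otimes> u \<oplus> x \<otimes> (\<ominus> (s \<otimes> c))) \<otimes> w [^] n'
          = (b \<otimes> h \<oplus> s \<otimes> x \<otimes> g) \<ominus> x \<otimes> s \<otimes> c \<otimes> w [^] n'"
        using uc hc gc wn(2) by algebra
      also have "\<dots> = b \<otimes> h \<oplus> (s \<otimes> x) \<otimes> g'"
        unfolding g'(3) using uc hc gc wn(2) by algebra
      finally have eq: "(b \<otimes> u \<oplus> x \<otimes> (\<ominus> (s \<otimes> c))) \<otimes> w [^] n' = b \<otimes> h \<oplus> (s \<otimes> x) \<otimes> g'" .
      have "s \<otimes> x \<in> S" using h(2) S(2) Scl by blast
      then have mem: "b \<otimes> h \<oplus> (s \<otimes> x) \<otimes> g' \<in> bounded_polys S w n'"
        using uc(6) h(1) g'(1)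
        by (intro bounded_polys_add bounded_polys_smult S w)
      have "\<ominus> (s \<otimes> c) \<in> S" using h(2) g'(2) Scl by blast
      then have inN: "b \<otimes> u \<oplus> x \<otimes> (\<ominus> (s \<otimes> c)) \<in> N"
        by (intro N(3,4) less.prems)
      show False
        by (rule less.hyps[OF _ inN mem[folded eq] less.prems(3-5)]) (simp add: Suc)
    next
      \<comment> \<open>Lowering \<open>m\<close>: multiply the relation for \<open>b\<close> by
        \<open>u\<close>, so that the top power of \<open>w\<close> can be rewritten by the integral
        equation. The constant that appears is a multiple of \<open>x\<close> and is moved to the
        left, again staying in \<open>N\<close>.\<close>
      case False
      then obtain m' where m': "m = Suc m'" by (cases m) auto
      then have nm: "n + (Suc m' - n) = Suc m'" using False by simp
      obtain g' c where g': "g' \<in> bounded_polys S w m'" "c \<in> S" "g = g' \<oplus> c \<otimes> w [^] m'"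
        using bounded_polys_lead[OF S(1) w(1)] less.prems(5) unfolding m' by blast
      have gc: "g' \<in> carrier R" "c \<in> carrier R" "w [^] m' \<in> carrier R" using g' P Sc w by auto
      have "u \<otimes> w [^] n \<otimes> w [^] (Suc m' - n) \<in> bounded_polys S w (Suc m')"
        using bounded_polys_times_pow[OF S(1) w(1) less.prems(2), of "Suc m' - n"] nm by simp
      moreover have "u \<otimes> w [^] n \<otimes> w [^] (Suc m' - n) = u \<otimes> w [^] Suc m'"
        using uc w(1) nm by (simp only: m_assoc nat_pow_closed nat_pow_mult)
      ultimately obtain e t where e: "e \<in> bounded_polys S w m'" "t \<in> S"
          "u \<otimes> w [^] Suc m' = e \<otimes> w \<oplus> t"
        using bounded_polys_SucE by metis
      have ec: "e \<in> carrier R" "t \<in> carrier R" using e P Sc by auto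
      have "u \<otimes> b = u \<otimes> (x \<otimes> (g \<otimes> w))" using less.prems(4) by simp
      also have "\<dots> = x \<otimes> (u \<otimes> g' \<otimes> w) \<oplus> x \<otimes> c \<otimes> (u \<otimes> (w [^] m' \<otimes> w))"
        unfolding g'(3) using uc gc w(1) by algebra
      also have "u \<otimes> (w [^] m' \<otimes> w) = e \<otimes> w \<oplus> t" using e(3) by simp
      finally have ub: "u \<otimes> b = x \<otimes> (u \<otimes> g' \<otimes> w) \<oplus> x \<otimes> c \<otimes> (e \<otimes> w \<oplus> t)" .
      have "u \<otimes> b \<oplus> x \<otimes> (\<ominus> (c \<otimes> t)) = x \<otimes> ((u \<otimes> g' \<oplus> c \<otimes> e) \<otimes> w)"
        unfolding ub using uc gc ec w(1) by algebra
      moreover have "u \<otimes> g' \<oplus> c \<otimes> e \<in> bounded_polys S w m'"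
        using uc(5) g'(1,2) e(1) by (intro bounded_polys_add bounded_polys_smult S w)
      moreover have "\<ominus> (c \<otimes> t) \<in> S" using g'(2) e(2) Scl by blast
      then have "u \<otimes> b \<oplus> x \<otimes> (\<ominus> (c \<otimes> t)) \<in> N"
        by (intro N(3,4) less.prems)
      ultimately show False
        using less.hyps[of n m', OF _ less.prems(1,2)] m' by simp
    qed
  qed
qed

text \<open>The coefficient \<open>u\<close> lies outside xA, so \<open>w\<close> is integral over
  the localization of \<open>A\<close> at xA. If \<open>w\<close> were missing from
  \<open>S\<close>, then S[w] would fail to be saturated; the failure supplies the second relation
  of the descent.\<close>

lemma (in domain) maximal_saturated_integrally_closed:
  assumes A: "discrete_at x A" "x \<noteq> \<zero>" and S: "subring S R" "saturated x A S"
    and max: "\<And>T. subring T R \<Longrightarrow> S \<subseteq> T \<Longrightarrow> saturated x A T \<Longrightarrow> T = S"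
    and w: "w \<in> carrier R" and u: "u \<in> A" "\<not> (\<exists>d\<in>A. u = x \<otimes> d)"
      "u \<otimes> w [^] (n::nat) \<in> bounded_polys A w n"
  shows "w \<in> S"
proof (rule ccontr)
  assume wS: "w \<notin> S"
  note subA = discrete_atD(1)[OF A(1)]
  have AS: "A \<subseteq> S" and sat: "\<And>b. b \<in> S \<Longrightarrow> x \<otimes> b \<in> A \<Longrightarrow> b \<in> A"
    using S(2) unfolding saturated_def by auto
  have xA: "x \<in> A" and xS: "x \<in> S" using discrete_atD(2)[OF A(1)] AS by auto
  have Sc: "s \<in> carrier R" if "s \<in> S" for s using that subringE(1)[OF S(1)] by blast
  have Ac: "s \<in> carrier R" if "s \<in> A" for s using that AS Sc by blast
  have xc: "x \<in> carrier R" using xS Sc by blast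
  note Scl = subringE(5-7)[OF S(1)] and Acl = subringE(5-7)[OF subA]
  have w0: "w \<noteq> \<zero>" using wS subringE(2)[OF S(1)] by auto
  let ?T = "simple_extension S w"
  note T = simple_extension_is_subring[OF S(1) w]
  have ST: "S \<subseteq> ?T" using simple_extension_incl[OF subringE(1)[OF S(1)] w] .
  have "w \<in> ?T" using simple_extension_mem[OF S(1) w] .
  then have "\<not> saturated x A ?T" using max[OF T ST] wS by auto
  then obtain b where b: "b \<in> ?T" "x \<otimes> b \<in> A" "b \<notin> A"
    using AS ST unfolding saturated_def by blast
  have bc: "b \<in> carrier R" using b(1) subringE(1)[OF T] by blast
  obtain m where m: "b \<in> bounded_polys S w m"
    using b(1) unfolding simple_extension_eq_UN by blast
  then obtain m' where m': "m = Suc m'"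
    using b(3) subringE(2)[OF subA] by (cases m) auto
  obtain g s where g: "g \<in> bounded_polys S w m'" "s \<in> S" "b = g \<otimes> w \<oplus> s"
    using bounded_polys_SucE m unfolding m' by metis
  have gc: "g \<in> carrier R" "s \<in> carrier R"
    using g Sc bounded_polys_carrier[OF S(1) w] by auto
  \<comment> \<open>The elements of \<open>S\<close> that agree modulo xS with an element of
    \<open>A\<close> outside xA. Products stay in \<open>N\<close> because xA is prime, and
    \<open>\<zero>\<close> is excluded because \<open>S\<close> is saturated.\<close>
  define N where "N = {a \<oplus> x \<otimes> s | a s. a \<in> A \<and> \<not> (\<exists>d\<in>A. a = x \<otimes> d) \<and> s \<in> S}"
  have NI: "a \<oplus> x \<otimes> s \<in> N" if "a \<in> A" "\<not> (\<exists>d\<in>A. a = x \<otimes> d)" "s \<in> S" for a s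
    using that unfolding N_def by blast
  have NE: "\<exists>a s. a \<in> A \<and> \<not> (\<exists>d\<in>A. a = x \<otimes> d) \<and> s \<in> S \<and> v = a \<oplus> x \<otimes> s" if "v \<in> N" for v
    using that unfolding N_def by blast
  show False
  proof (rule bounded_polys_descent[OF S(1) xS w w0, of N])
    show "N \<subseteq> S"
      unfolding N_def using AS xS Scl by blast
    show "\<zero> \<notin> N"
    proof
      assume "\<zero> \<in> N"
      then obtain a s where *: "a \<in> A" "\<not> (\<exists>d\<in>A. a = x \<otimes> d)" "s \<in> S" "\<zero> = a \<oplus> x \<otimes> s"
        using NE by blast
      have c: "a \<in> carrier R" "s \<in> carrier R" using * Ac Sc by auto
      have "a = (a \<oplus> x \<otimes> s) \<oplus> x \<otimes> (\<ominus> s)" using c xc by algebra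
      then have "a = x \<otimes> (\<ominus> s)" unfolding *(4)[symmetric] using c xc by simp
      moreover have "\<ominus> s \<in> A"
        using sat[of "\<ominus> s"] calculation *(1,3) Scl(1) by auto
      ultimately show False using *(2) by blast
    qed
    show "v \<otimes> v' \<in> N" if vN: "v \<in> N" and vN': "v' \<in> N" for v v'
    proof -
      obtain a s where v: "a \<in> A" "\<not> (\<exists>d\<in>A. a = x \<otimes> d)" "s \<in> S" "v = a \<oplus> x \<otimes> s"
        using NE[OF vN] by blast
      obtain a' s' where v': "a' \<in> A" "\<not> (\<exists>d\<in>A. a' = x \<otimes> d)" "s' \<in> S" "v' = a' \<oplus> x \<otimes> s'"
        using NE[OF vN'] by blast
      have c: "a \<in> carrier R" "s \<in> carrier R" "a' \<in> carrier R" "s' \<in> carrier R"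
        using v v' Ac Sc by auto
      have "v \<otimes> v' = a \<otimes> a' \<oplus> x \<otimes> (a \<otimes> s' \<oplus> s \<otimes> a' \<oplus> x \<otimes> s \<otimes> s')"
        unfolding v(4) v'(4) using c xc by algebra
      moreover have "\<not> (\<exists>d\<in>A. a \<otimes> a' = x \<otimes> d)"
        using discrete_atD(3)[OF A(1) v(1) v'(1)] v(2) v'(2) by blast
      moreover have "a \<in> S" "a' \<in> S" using v v' AS by auto
      then have "a \<otimes> s' \<oplus> s \<otimes> a' \<oplus> x \<otimes> s \<otimes> s' \<in> S"
        using v(3) v'(3) xS by (intro Scl(2,3))
      ultimately show ?thesis
        using NI[OF Acl(2)[OF v(1) v'(1)]] by simp
    qed
    show "v \<oplus> x \<otimes> s \<in> N" if vN: "v \<in> N" and sS: "s \<in> S" for v s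
    proof -
      obtain a t where v: "a \<in> A" "\<not> (\<exists>d\<in>A. a = x \<otimes> d)" "t \<in> S" "v = a \<oplus> x \<otimes> t"
        using NE[OF vN] by blast
      have "v \<oplus> x \<otimes> s = a \<oplus> x \<otimes> (t \<oplus> s)"
        unfolding v(4) using v Ac Sc sS xc by (simp add: r_distr a_assoc)
      then show ?thesis using NI[OF v(1,2) Scl(3)[OF v(3) sS]] by simp
    qed
    show "u \<in> N"
      using NI[OF u(1,2) subringE(2)[OF S(1)]] u(1) Ac xc by simp
    show "u \<otimes> w [^] n \<in> bounded_polys S w n"
      using u(3) bounded_polys_subset[OF AS] by blast
    \<comment> \<open>As \<open>b\<close> is not in \<open>A\<close>, the element
      \<open>x \<otimes> b\<close> of \<open>A\<close> lies outside xA. Subtracting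
      \<open>x \<otimes> s\<close> keeps it in \<open>N\<close> and leaves a multiple of
      \<open>w\<close>, as the descent requires.\<close>
    have "x \<otimes> b \<noteq> x \<otimes> d" if "d \<in> A" for d
      using m_lcancel[OF A(2) xc bc Ac[OF that]] b(3) that by auto
    then have "x \<otimes> b \<oplus> x \<otimes> (\<ominus> s) \<in> N"
      using NI[OF b(2)] Scl(1)[OF g(2)] by blast
    moreover have "x \<otimes> b \<oplus> x \<otimes> (\<ominus> s) = x \<otimes> (g \<otimes> w)"
      unfolding g(3) using gc xc w by algebra
    ultimately show "x \<otimes> (g \<otimes> w) \<in> N" by simp
    show "x \<otimes> (g \<otimes> w) = x \<otimes> (g \<otimes> w)" ..
    show "g \<in> bounded_polys S w m'" by fact
  qed
qed

theorem (in domain) submaximal_if_discrete_at_unit: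
  assumes x: "x \<in> Units R" and A: "discrete_at x A"
  shows "submaximal R"
proof -
  have xc: "x \<in> carrier R" "inv x \<in> carrier R"
    using x by auto
  have x0: "x \<noteq> \<zero>"
    using Units_r_inv[OF x] xc(2) by auto
  obtain M where M: "discrete_at x M"
    and maxM: "\<And>B. discrete_at x B \<Longrightarrow> saturated x M B \<Longrightarrow> B = M"
    using exists_maximal_discrete_at[OF A] by metis
  note sub = discrete_atD(1)[OF M]
  have Mc: "a \<in> carrier R" if "a \<in> M" for a using that subringE(1)[OF sub] by blast
  have not_free: "\<not> free_over M y" if y: "y \<in> carrier R" for y
  proof
    \<comment> \<open>Maximality would force \<open>y\<close> into \<open>M\<close>, but then
      \<open>\<one> \<otimes> y \<oplus> \<ominus> y\<close> is a nontrivial relation for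
      \<open>y\<close>. Hence all of \<open>R\<close> is algebraic over \<open>M\<close>.\<close>
    assume free: "free_over M y"
    have "simple_extension M y = M"
      using maxM[OF discrete_at_free_extension[OF M x0 y free]] .
    then have "y \<in> M"
      using simple_extension_mem[OF sub y] by simp
    have "\<one> \<in> simple_extension M y"
      using subringE(3)[OF simple_extension_is_subring[OF sub y]] .
    moreover have "\<one> \<otimes> y \<oplus> \<ominus> y = \<zero>" using y by (simp add: r_neg)
    ultimately have "\<one> = \<zero>"
      using free subringE(5)[OF sub \<open>y \<in> M\<close>] unfolding free_over_def by blast
    then show False by simp
  qed
  \<comment> \<open>For a subring containing \<open>M\<close>, avoiding this set is exactly being
    saturated over \<open>M\<close>.\<close>
  define E where "E = {b \<in> carrier R. x \<otimes> b \<in> M \<and> b \<notin> M}"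
  have "M \<inter> E = {}" unfolding E_def by blast
  then obtain S where S: "subring S R" "M \<subseteq> S" "S \<inter> E = {}"
    and maxS: "\<And>T. subring T R \<Longrightarrow> S \<subseteq> T \<Longrightarrow> T \<inter> E = {} \<Longrightarrow> T = S"
    using exists_maximal_subring_avoiding[OF sub] by metis
  have satS: "saturated x M S"
    using S subringE(1)[OF S(1)] unfolding saturated_def E_def by blast
  have maxS': "T = S" if "subring T R" "S \<subseteq> T" "saturated x M T" for T
  proof -
    have "T \<inter> E = {}" using that(3) unfolding saturated_def E_def by blast
    then show ?thesis using maxS that by blast
  qed
  \<comment> \<open>Saturation would put \<open>inv x\<close> into \<open>M\<close>, making
    \<open>\<one>\<close> divisible by all powers of \<open>x\<close> there.\<close>
  have "inv x \<notin> S"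
  proof
    assume "inv x \<in> S"
    moreover have "x \<otimes> inv x \<in> M" using x subringE(3)[OF sub] by simp
    ultimately have "inv x \<in> M" using satS unfolding saturated_def by blast
    then have pow: "inv x [^] k \<in> M" for k :: nat using subring_pow_closed[OF sub] by blast
    obtain k :: nat where k: "\<forall>b\<in>M. \<one> \<noteq> x [^] k \<otimes> b"
      using discrete_atD(4)[OF M subringE(3)[OF sub]] by auto
    have "\<one> = x [^] k \<otimes> inv x [^] k"
      using x xc by (simp add: nat_pow_distrib[symmetric])
    then show False using k pow by blast
  qed
  moreover have "\<exists>k::nat. x [^] k \<otimes> z \<in> S" if z: "z \<in> carrier R" for z
  proof -
    obtain n c where c: "c \<in> M" "c \<noteq> \<zero>" "c \<otimes> z [^] (n::nat) \<in> bounded_polys M z n"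
      using not_free_over_lead[OF sub z not_free[OF z]] by metis
    have cc: "c \<in> carrier R" using c Mc by blast
    obtain n' where n': "n = Suc n'"
      using c cc by (cases n) auto
    \<comment> \<open>The first exponent whose power of \<open>x\<close> fails to divide
      \<open>c\<close>; it is positive since \<open>c\<close> divides itself at exponent zero. Its
      predecessor \<open>k\<close> is the exact order of \<open>c\<close>, which leaves a cofactor
      \<open>u\<close> outside xM.\<close>
    define K where "K = (LEAST k::nat. \<forall>b\<in>M. c \<noteq> x [^] k \<otimes> b)"
    have K: "\<forall>b\<in>M. c \<noteq> x [^] K \<otimes> b"
      unfolding K_def using discrete_atD(4)[OF M c(1,2)] by (rule LeastI_ex)
    have "K \<noteq> 0"
    proof
      assume "K = 0"
      then show False using bspec[OF K c(1)] cc by simp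
    qed
    then obtain k where k: "K = Suc k" by (cases K) auto
    have "\<not> (\<forall>b\<in>M. c \<noteq> x [^] k \<otimes> b)"
      using not_less_Least[of k "\<lambda>k. \<forall>b\<in>M. c \<noteq> x [^] k \<otimes> b"] k unfolding K_def by simp
    then obtain u where u: "u \<in> M" "c = x [^] k \<otimes> u" by blast
    have uc: "u \<in> carrier R" using u Mc by blast
    have ndvd: "\<not> (\<exists>d\<in>M. u = x \<otimes> d)"
    proof
      assume "\<exists>d\<in>M. u = x \<otimes> d"
      then obtain d where d: "d \<in> M" "u = x \<otimes> d" by blast
      then have "c = x [^] K \<otimes> d" using u k xc Mc by (simp add: m_assoc)
      then show False using K d by blast
    qed
    have xk: "x [^] k \<in> M" using subring_pow_closed[OF sub discrete_atD(2)[OF M]] .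
    \<comment> \<open>One factor \<open>x [^] k\<close> fewer than the degree n is enough, because
      \<open>c\<close> already contributes one.\<close>
    have "(x [^] k) [^] n' \<otimes> (c \<otimes> z [^] n) = u \<otimes> (x [^] k \<otimes> z) [^] n"
    proof -
      have "(x [^] k \<otimes> z) [^] n = (x [^] k) [^] n' \<otimes> x [^] k \<otimes> z [^] n"
        using xc z unfolding n' by (simp add: nat_pow_distrib m_ac)
      then show ?thesis unfolding u(2) using xc z uc by (simp add: m_ac)
    qed
    then have "u \<otimes> (x [^] k \<otimes> z) [^] n \<in> bounded_polys M (x [^] k \<otimes> z) n"
      using bounded_polys_rescale[OF sub xk z c(3)[unfolded n']] n' by simp
    then have "x [^] k \<otimes> z \<in> S"
      using maximal_saturated_integrally_closed[OF M x0 S(1) satS maxS' _ u(1) ndvd] xc z by simp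
    then show ?thesis by blast
  qed
  ultimately show ?thesis
    using maximal_subring_if_localization[OF x S(1)] by blast
qed

section \<open>Base cases over the prime subring\<close>

text \<open>Constant terms multiply and \<open>B\<close> has no zero divisors, so \<open>y\<close>
  generates a prime ideal of B[y]; the order of vanishing in \<open>y\<close> gives
  separation.\<close>

lemma (in domain) discrete_at_transcendental:
  assumes B: "subring B R" and y: "y \<in> carrier R" "y \<noteq> \<zero>" "free_over B y"
  shows "discrete_at y (simple_extension B y)"
proof -
  let ?E = "simple_extension B y"
  note E = simple_extension_is_subring[OF B y(1)]
  have Ec: "e \<in> carrier R" if "e \<in> ?E" for e using that subringE(1)[OF E] by blast
  have Bc: "e \<in> carrier R" if "e \<in> B" for e using that subringE(1)[OF B] by blast
  have BE: "e \<in> ?E" if "e \<in> B" for e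
    using simple_extension_incl[OF subringE(1)[OF B] y(1)] that by blast
  have yE: "y \<in> ?E" using simple_extension_mem[OF B y(1)] .
  \<comment> \<open>Compare with \<open>d \<otimes> y \<oplus> \<zero>\<close>: a multiple of
    \<open>y\<close> has constant term zero and a unique quotient.\<close>
  have div: "a = \<zero> \<and> f = d" if "f \<in> ?E" "a \<in> B" "d \<in> ?E" "f \<otimes> y \<oplus> a = y \<otimes> d" for f a d
    using free_over_decomp_unique[OF B y(1,3) that(1,3,2) subringE(2)[OF B]] that(4) y(1) Ec[OF that(3)]
    by (simp add: m_comm)
  have "\<exists>d\<in>?E. f = y \<otimes> d \<or> g = y \<otimes> d"
    if fE: "f \<in> ?E" and gE: "g \<in> ?E" and cE: "c \<in> ?E" and fg: "f \<otimes> g = y \<otimes> c" for f g c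
  proof -
    obtain f' a where f: "f' \<in> ?E" "a \<in> B" "f = f' \<otimes> y \<oplus> a"
      using simple_extension_cases[OF fE y(1) B] by metis
    obtain g' b where g: "g' \<in> ?E" "b \<in> B" "g = g' \<otimes> y \<oplus> b"
      using simple_extension_cases[OF gE y(1) B] by metis
    note c = Ec[OF f(1)] Bc[OF f(2)] Ec[OF g(1)] Bc[OF g(2)] y(1)
    have "(f' \<otimes> g' \<otimes> y \<oplus> f' \<otimes> b \<oplus> a \<otimes> g') \<otimes> y \<oplus> a \<otimes> b = f \<otimes> g"
      unfolding f(3) g(3) using c by algebra
    moreover have "f' \<otimes> g' \<otimes> y \<oplus> f' \<otimes> b \<oplus> a \<otimes> g' \<in> ?E"
      using f(1) BE[OF f(2)] g(1) BE[OF g(2)] yE by (intro subringE(6,7)[OF E])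
    ultimately have "a \<otimes> b = \<zero>"
      using div[OF _ subringE(6)[OF B f(2) g(2)] cE] fg by simp
    then have "a = \<zero> \<or> b = \<zero>"
      using integral c by blast
    then have "f = y \<otimes> f' \<or> g = y \<otimes> g'"
      using f(3) g(3) c by (auto simp: m_comm)
    then show ?thesis using f(1) g(1) by blast
  qed
  moreover have "\<exists>k::nat. \<forall>d\<in>?E. f \<noteq> y [^] k \<otimes> d" if "f \<in> ?E" "f \<noteq> \<zero>" for f
    using that
  proof (induction rule: simple_extension.induct)
    case (lin f a)
    note c = Ec[OF lin(1)] Bc[OF lin(2)] y(1)
    show ?case
    proof (cases "a = \<zero>")
      case False
      have "f \<otimes> y \<oplus> a \<noteq> y [^] (1::nat) \<otimes> d" if "d \<in> ?E" for d
        using div[OF lin(1,2) that] False y(1) by auto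
      then show ?thesis by blast
    next
      case True
      then have "f \<noteq> \<zero>" using lin(4) c by auto
      then obtain k :: nat where k: "\<forall>d\<in>?E. f \<noteq> y [^] k \<otimes> d" using lin(3) by blast
      have "f \<otimes> y \<oplus> a \<noteq> y [^] Suc k \<otimes> d" if d: "d \<in> ?E" for d
      proof
        assume eq: "f \<otimes> y \<oplus> a = y [^] Suc k \<otimes> d"
        have "y [^] Suc k \<otimes> d = y \<otimes> (y [^] k \<otimes> d)"
          using y(1) Ec[OF d] by (simp add: m_ac)
        moreover have "y [^] k \<otimes> d \<in> ?E"
          using subring_pow_closed[OF E yE] d subringE(6)[OF E] by blast
        ultimately have "f = y [^] k \<otimes> d"
          using div[OF lin(1,2)] eq by simp
        then show False using k d by blast
      qed
      then show ?thesis by blast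
    qed
  qed simp
  ultimately show ?thesis
    unfolding discrete_at_def using E yE by blast
qed

section \<open>The prime subring as an image of the integers\<close>

context domain
begin

abbreviation of_integer :: "int \<Rightarrow> 'a" where "of_integer n \<equiv> [n] \<cdot> \<one>"

lemma of_integer_0: "of_integer 0 = \<zero>"
  using int_pow_0[of "add_monoid R"] by (simp add: add_pow_def)

lemma of_integer_add: "of_integer (m + n) = of_integer m \<oplus> of_integer n"
  using add.int_pow_mult[of \<one> m n] by simp

lemma of_integer_uminus: "of_integer (- n) = \<ominus> of_integer n"
  using add.int_pow_neg[of \<one> n] by (simp add: a_inv_def)

lemma of_integer_mult: "of_integer (m * n) = of_integer m \<otimes> of_integer n"
  using add.int_pow_pow[of \<one> m n] add_pow_ldistr_int[of \<one> "of_integer n" m]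
  by (simp add: mult.commute[of m n])

lemma of_integer_pow: "of_integer (m ^ k) = of_integer m [^] k"
  by (induction k) (simp_all add: of_integer_mult m_comm)

lemma prime_subring_is_subring: "subring (prime_subring R) R"
proof (rule subringI)
  show "prime_subring R \<subseteq> carrier R" unfolding prime_subring_def by auto
  show "\<one> \<in> prime_subring R"
    unfolding prime_subring_def by (rule range_eqI[of _ _ 1]) simp
  show "\<ominus> h \<in> prime_subring R" if "h \<in> prime_subring R" for h
    using that unfolding prime_subring_def by (auto simp: of_integer_uminus[symmetric])
  show "h \<otimes> h' \<in> prime_subring R" "h \<oplus> h' \<in> prime_subring R"
    if "h \<in> prime_subring R" "h' \<in> prime_subring R" for h h'
    using that unfolding prime_subring_def
    by (auto simp: of_integer_mult[symmetric] of_integer_add[symmetric])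
qed

text \<open>Such a prime forces characteristic zero. If m vanishes in the ring, a factor p of m can
  be cancelled, giving a smaller example; if p does not divide m, a Bezout identity makes p a
  unit.\<close>

lemma of_integer_eq_zero_iff_if_nonunit_prime:
  assumes p: "Factorial_Ring.prime (p::int)" "of_integer p \<notin> Units R" "of_integer p \<noteq> \<zero>"
  shows "of_integer m = \<zero> \<longleftrightarrow> m = 0"
proof
  assume "of_integer m = \<zero>"
  then show "m = 0"
  proof (induction "nat \<bar>m\<bar>" arbitrary: m rule: less_induct)
    case less
    show ?case
    proof (rule ccontr)
      assume m: "m \<noteq> 0"
      show False
      proof (cases "p dvd m")
        case True
        then obtain k where k: "m = p * k" by (rule dvdE)
        have "of_integer p \<otimes> of_integer k = \<zero>"
          using less.prems unfolding k of_integer_mult .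
        then have "of_integer k = \<zero>"
          using p(3) integral[of "of_integer p" "of_integer k"] by simp
        moreover have "1 * \<bar>k\<bar> < p * \<bar>k\<bar>"
          using m k prime_gt_1_int[OF p(1)] by (intro mult_strict_right_mono) auto
        then have "\<bar>k\<bar> < \<bar>m\<bar>"
          using prime_ge_0_int[OF p(1)] unfolding k abs_mult by simp
        then have "nat \<bar>k\<bar> < nat \<bar>m\<bar>" by linarith
        ultimately have "k = 0" using less.hyps by blast
        then show False using m k by simp
      next
        case False
        then have "gcd p m = 1" using prime_imp_coprime[OF p(1)] by (simp add: coprime_iff_gcd_eq_1)
        then obtain u v where uv: "u * p + v * m = 1" using bezout_int[of p m] by auto
        have "of_integer u \<otimes> of_integer p \<oplus> of_integer v \<otimes> of_integer m = of_integer (u * p + v * m)"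
          by (simp only: of_integer_add of_integer_mult)
        also have "\<dots> = \<one>" unfolding uv by simp
        finally have "of_integer u \<otimes> of_integer p = \<one>"
          unfolding less.prems by simp
        then have "of_integer p \<in> Units R"
          unfolding Units_def using m_comm[of "of_integer u" "of_integer p"]
          by (intro CollectI conjI bexI[of _ "of_integer u"]) simp_all
        then show False using p(2) by blast
      qed
    qed
  qed
qed (simp add: of_integer_0)

text \<open>The prime subring is a copy of the integers by the preceding characteristic argument, so
  primality and separation are inherited from there.\<close>

lemma discrete_at_prime_integer:
  assumes p: "Factorial_Ring.prime (p::int)" "of_integer p \<notin> Units R" "of_integer p \<noteq> \<zero>"
  shows "discrete_at (of_integer p) (prime_subring R)"
proof -
  have inj: "m = n" if "of_integer m = of_integer n" for m n
  proof -
    have "of_integer (m + - n) = \<zero>"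
      unfolding of_integer_add of_integer_uminus that by (simp add: r_neg)
    then show ?thesis using of_integer_eq_zero_iff_if_nonunit_prime[OF p] by simp
  qed
  show ?thesis
    unfolding discrete_at_def
  proof (intro conjI ballI impI)
    show "subring (prime_subring R) R" by (rule prime_subring_is_subring)
    show "of_integer p \<in> prime_subring R" unfolding prime_subring_def by simp
  next
    fix a b c
    assume "a \<in> prime_subring R" "b \<in> prime_subring R" "c \<in> prime_subring R"
      and eq: "a \<otimes> b = of_integer p \<otimes> c"
    then obtain k m n where abc: "a = of_integer k" "b = of_integer m" "c = of_integer n"
      unfolding prime_subring_def by blast
    then have "k * m = p * n" using eq inj by (simp add: of_integer_mult[symmetric])
    then have "p dvd k \<or> p dvd m"
      using p(1) by (metis dvd_triv_left prime_dvd_mult_iff)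
    then obtain d where "k = p * d \<or> m = p * d" by (auto elim: dvdE)
    then show "\<exists>d\<in>prime_subring R. a = of_integer p \<otimes> d \<or> b = of_integer p \<otimes> d"
      unfolding abc prime_subring_def
      by (intro bexI[of _ "of_integer d"]) (auto simp: of_integer_mult)
  next
    fix a assume "a \<in> prime_subring R - {\<zero>}"
    then obtain n where n: "a = of_integer n" "n \<noteq> 0"
      unfolding prime_subring_def using of_integer_0 by auto
    \<comment> \<open>The exponent may be taken to be \<open>\<bar>n\<bar>\<close> itself: the power
      exceeds \<open>\<bar>n\<bar>\<close> and so cannot divide a nonzero n.\<close>
    have "\<bar>n\<bar> < p ^ nat \<bar>n\<bar>"
    proof -
      have "nat \<bar>n\<bar> < 2 ^ nat \<bar>n\<bar>" by (rule less_exp)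
      then have "int (nat \<bar>n\<bar>) < int (2 ^ nat \<bar>n\<bar>)" by (simp only: of_nat_less_iff)
      then have "\<bar>n\<bar> < 2 ^ nat \<bar>n\<bar>" by simp
      also have "\<dots> \<le> p ^ nat \<bar>n\<bar>" using prime_ge_2_int[OF p(1)] by (intro power_mono) auto
      finally show ?thesis .
    qed
    then have ndvd: "\<not> p ^ nat \<bar>n\<bar> dvd n"
      using n(2) zdvd_not_zless[of "\<bar>n\<bar>" "p ^ nat \<bar>n\<bar>"] by simp
    have "a \<noteq> of_integer p [^] nat \<bar>n\<bar> \<otimes> of_integer m" for m
    proof
      assume "a = of_integer p [^] nat \<bar>n\<bar> \<otimes> of_integer m"
      then have "n = p ^ nat \<bar>n\<bar> * m"
        unfolding n(1) by (intro inj) (simp add: of_integer_mult of_integer_pow)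
      then show False using ndvd dvd_triv_left by metis
    qed
    then show "\<exists>k::nat. \<forall>b\<in>prime_subring R. a \<noteq> of_integer p [^] k \<otimes> b"
      unfolding prime_subring_def by blast
  qed
qed

text \<open>The least natural number with nonzero nonunit image is prime: in a proper factorization
  both factors have nonzero images, so by minimality these are units, and so is their
  product.\<close>

lemma nonunit_integer_imp_nonunit_prime:
  assumes n: "of_integer n \<noteq> \<zero>" "of_integer n \<notin> Units R"
  obtains p :: int where "Factorial_Ring.prime p" "of_integer p \<noteq> \<zero>" "of_integer p \<notin> Units R"
proof -
  define P where "P k \<longleftrightarrow> of_integer (int k) \<noteq> \<zero> \<and> of_integer (int k) \<notin> Units R" for k
  have "P (nat \<bar>n\<bar>)"
  proof (cases "n \<ge> 0")
    case False
    have "of_integer n = \<ominus> \<one> \<otimes> of_integer (- n)"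
      by (simp add: of_integer_uminus l_minus)
    then have "of_integer (- n) \<in> Units R \<Longrightarrow> of_integer n \<in> Units R"
      by (metis Units_m_closed Units_minus_one_closed)
    then show ?thesis using n False unfolding P_def by (auto simp: of_integer_uminus)
  qed (use n in \<open>simp add: P_def\<close>)
  define p where "p = (LEAST k. P k)"
  have p: "P p" unfolding p_def using \<open>P (nat \<bar>n\<bar>)\<close> by (rule LeastI)
  have least: "\<not> P k" if "k < p" for k using that unfolding p_def by (rule not_less_Least)
  have "p \<noteq> 0"
  proof
    assume "p = 0"
    then show False using p of_integer_0 unfolding P_def by simp
  qed
  moreover have "p \<noteq> 1" using p unfolding P_def by auto
  moreover have "k = 1 \<or> k = p" if k: "k dvd p" for k
  proof (rule ccontr)
    assume "\<not> (k = 1 \<or> k = p)"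
    obtain m where m: "p = k * m" using k by blast
    have "k \<le> p" "m \<le> p" "m \<noteq> p"
      using \<open>\<not> (k = 1 \<or> k = p)\<close> \<open>p \<noteq> 0\<close> m by auto
    then have "k < p" "m < p"
      using \<open>\<not> (k = 1 \<or> k = p)\<close> by auto
    moreover have prod: "of_integer (int p) = of_integer (int k) \<otimes> of_integer (int m)"
      unfolding m by (simp add: of_integer_mult)
    moreover have "of_integer (int k) \<noteq> \<zero>" "of_integer (int m) \<noteq> \<zero>"
      using p prod unfolding P_def by auto
    ultimately have "of_integer (int k) \<in> Units R" "of_integer (int m) \<in> Units R"
      using least unfolding P_def by blast+
    then show False using p prod Units_m_closed unfolding P_def by simp
  qed
  ultimately have "Factorial_Ring.prime p" by (auto simp: prime_nat_iff)
  then show thesis using that[of "int p"] p unfolding P_def by simp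
qed

text \<open>In a relation of least degree the constant term \<open>a\<close> is nonzero, since
  otherwise \<open>y\<close> could be cancelled; all other terms are multiples of
  \<open>y\<close>.\<close>

lemma not_free_over_imp_divides_const:
  assumes B: "subring B R" and y: "y \<in> carrier R" "y \<noteq> \<zero>" "\<not> free_over B y"
  obtains a d where "a \<in> B" "a \<noteq> \<zero>" "d \<in> carrier R" "a = y \<otimes> d"
proof -
  define Q where "Q n \<longleftrightarrow> (\<exists>c\<in>B. c \<noteq> \<zero> \<and> c \<otimes> y [^] (n::nat) \<in> bounded_polys B y n)" for n
  have "\<exists>n. Q n" using not_free_over_lead[OF B y(1,3)] unfolding Q_def by metis
  then have Q: "Q (LEAST n. Q n)" by (rule LeastI_ex)
  define n where "n = (LEAST n. Q n)"
  obtain c where c: "c \<in> B" "c \<noteq> \<zero>" "c \<otimes> y [^] n \<in> bounded_polys B y n"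
    using Q unfolding n_def Q_def[of "LEAST n. Q n"] by blast
  have cc: "c \<in> carrier R" using c subringE(1)[OF B] by blast
  then obtain m where m: "n = Suc m" using c by (cases n) auto
  obtain g a where g: "g \<in> bounded_polys B y m" "a \<in> B" "c \<otimes> y [^] n = g \<otimes> y \<oplus> a"
    using c(3) bounded_polys_SucE unfolding m by metis
  have gc: "g \<in> carrier R" "a \<in> carrier R"
    using g bounded_polys_carrier[OF B y(1)] subringE(1)[OF B] by auto
  have "a \<noteq> \<zero>"
  proof
    assume "a = \<zero>"
    then have "(c \<otimes> y [^] m) \<otimes> y = g \<otimes> y"
      using g(3) gc cc y(1) unfolding m by (simp add: m_assoc)
    then have "c \<otimes> y [^] m = g"
      using m_rcancel[OF y(2,1)] gc cc y(1) by simp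
    then have "Q m" using c g unfolding Q_def by auto
    then show False using not_less_Least[of m Q] m unfolding n_def by simp
  qed
  moreover have "a = y \<otimes> (c \<otimes> y [^] m \<ominus> g)"
  proof -
    have "y \<otimes> (c \<otimes> y [^] m \<ominus> g) = c \<otimes> y [^] n \<ominus> g \<otimes> y"
      using gc cc y(1) unfolding m by (simp add: a_minus_def r_distr r_minus m_ac)
    also have "\<dots> = a" unfolding g(3) using gc y(1) by algebra
    finally show ?thesis by simp
  qed
  ultimately show thesis
    using that[OF g(2), of "c \<otimes> y [^] m \<ominus> g"] gc cc y(1) by simp
qed

text \<open>A divisor \<open>p\<close> of a nonzero integer makes that integer a nonunit, which
  yields a prime number in the algebraic case. Keeping \<open>A\<close> inside Z[p] lets a divisor
  hypothesis on Z[p] cover \<open>A\<close>.\<close>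

lemma exists_discrete_at_nonunit:
  assumes p: "p \<in> carrier R" "p \<noteq> \<zero>" "p \<notin> Units R"
  obtains x A where "discrete_at x A" "x \<noteq> \<zero>" "x \<notin> Units R"
    "A \<subseteq> simple_extension (prime_subring R) p"
proof (cases "free_over (prime_subring R) p")
  case True
  then show thesis
    using that discrete_at_transcendental[OF prime_subring_is_subring p(1,2)] p by blast
next
  case False
  obtain a d where a: "a \<in> prime_subring R" "a \<noteq> \<zero>" "d \<in> carrier R" "a = p \<otimes> d"
    using not_free_over_imp_divides_const[OF prime_subring_is_subring p(1,2) False] by metis
  have "a \<notin> Units R"
    using unit_factor[of p d] a p by blast
  then obtain q :: int where q: "Factorial_Ring.prime q" "of_integer q \<noteq> \<zero>" "of_integer q \<notin> Units R"
    using nonunit_integer_imp_nonunit_prime a unfolding prime_subring_def by blast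
  have "prime_subring R \<subseteq> simple_extension (prime_subring R) p"
    using simple_extension_incl[OF subringE(1)[OF prime_subring_is_subring] p(1)] .
  then show thesis
    using that discrete_at_prime_integer[OF q(1,3,2)] q by blast
qed

end

section \<open>Quotients and counting\<close>

text \<open>The correspondence theorem: the preimage of a subring contains the kernel, so a subring
  above it is determined by its image.\<close>

lemma (in ring_hom_ring) submaximal_vimage:
  assumes surj: "h ` carrier R = carrier S" and S: "submaximal S"
  shows "submaximal R"
proof -
  obtain T where T: "subring T S" "T \<noteq> carrier S"
    and max: "\<And>U. subring U S \<Longrightarrow> T \<subseteq> U \<Longrightarrow> U = T \<or> U = carrier S"
    using S unfolding submaximal_def maximal_subring_def by blast
  define P where "P = {r \<in> carrier R. h r \<in> T}"
  have PI: "r \<in> P" if "r \<in> carrier R" "h r \<in> T" for r using that unfolding P_def by blast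
  have PD: "r \<in> carrier R" "h r \<in> T" if "r \<in> P" for r using that unfolding P_def by auto
  have "subring P R"
  proof (rule R.subringI)
    show "P \<subseteq> carrier R" using PD(1) by blast
    show "\<one> \<in> P" using subringE(3)[OF T(1)] by (intro PI) simp_all
    show "\<ominus> r \<in> P" if "r \<in> P" for r
      using PD[OF that] subringE(5)[OF T(1)] by (intro PI) simp_all
    show "r \<otimes> s \<in> P" "r \<oplus> s \<in> P" if "r \<in> P" "s \<in> P" for r s
      using PD[OF that(1)] PD[OF that(2)] subringE(6,7)[OF T(1)] by (auto intro!: PI)
  qed
  moreover have "P \<noteq> carrier R"
  proof
    assume "P = carrier R"
    then have "h ` carrier R \<subseteq> T" using PD(2) by (simp add: image_subset_iff)
    then show False using T(2) subringE(1)[OF T(1)] unfolding surj by (simp add: subset_antisym)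
  qed
  moreover have "U = P \<or> U = carrier R" if U: "subring U R" "P \<subseteq> U" for U
  proof -
    have UR: "U \<subseteq> carrier R" using subringE(1)[OF U(1)] .
    have "T \<subseteq> h ` U"
    proof
      fix t assume t: "t \<in> T"
      then have "t \<in> h ` carrier R" unfolding surj using subringE(1)[OF T(1)] by (rule subsetD[rotated])
      then obtain r where r: "t = h r" "r \<in> carrier R" by (rule imageE)
      then have "r \<in> U" using t PI[of r] U(2) by (simp add: subset_iff)
      then show "t \<in> h ` U" using r(1) by (simp add: imageI)
    qed
    then consider "h ` U = T" | "h ` U = carrier S"
      using max[OF img_is_subring[OF U(1)] \<open>T \<subseteq> h ` U\<close>] by (elim disjE)
    then show ?thesis
    proof cases
      case 1
      then have "U \<subseteq> P" using PI UR by (simp add: subset_iff set_eq_iff image_iff) metis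
      then show ?thesis using U(2) by (simp add: subset_antisym)
    next
      case 2
      have "r \<in> U" if r: "r \<in> carrier R" for r
      proof -
        have "h r \<in> h ` U" using 2 r by simp
        then obtain u where u: "u \<in> U" "h r = h u" by (rule imageE)
        have uc: "u \<in> carrier R" using UR u(1) by (rule subsetD)
        have "h (r \<ominus> u) = \<zero>\<^bsub>S\<^esub>"
          using u uc r by (simp add: a_minus_def S.r_neg)
        then have "r \<ominus> u \<in> U"
          using PI[of "r \<ominus> u"] U(2) subringE(2)[OF T(1)] r uc by (simp add: subset_iff)
        then have "(r \<ominus> u) \<oplus> u \<in> U"
          using subringE(7)[OF U(1)] u(1) by simp
        then show ?thesis
          using r uc by (simp add: a_minus_def R.a_assoc R.l_neg)
      qed
      then have "carrier R \<subseteq> U" by (rule subsetI)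
      then show ?thesis using UR by (simp add: subset_antisym)
    qed
  qed
  ultimately show ?thesis
    unfolding submaximal_def maximal_subring_def by (intro exI[of _ P] conjI allI impI) simp_all
qed

text \<open>Every clause of \<open>discrete_at\<close> concerns products of elements of
  \<open>A\<close>, and \<open>h\<close> is an isomorphism from \<open>A\<close> onto its image,
  whatever its kernel on \<open>R\<close>.\<close>

lemma (in ring_hom_ring) discrete_at_image:
  assumes A: "R.discrete_at x A" and inj: "inj_on h A"
  shows "S.discrete_at (h x) (h ` A)"
proof -
  note sub = R.discrete_atD(1)[OF A] and xA = R.discrete_atD(2)[OF A]
  have Ac: "a \<in> carrier R" if "a \<in> A" for a using that subringE(1)[OF sub] by blast
  have mult: "h a \<otimes>\<^bsub>S\<^esub> h b = h (a \<otimes> b)" if "a \<in> A" "b \<in> A" for a b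
    using that Ac by simp
  have pow: "h x [^]\<^bsub>S\<^esub> k = h (x [^] k)" for k :: nat
    using Ac[OF xA] by (induction k) simp_all
  have inj': "a = b" if "h a = h b" "a \<in> A" "b \<in> A" for a b
    using inj_onD[OF inj that] .
  have cl: "a \<otimes> b \<in> A" if "a \<in> A" "b \<in> A" for a b
    using subringE(6)[OF sub that] .
  have xk: "x [^] k \<in> A" for k :: nat using R.subring_pow_closed[OF sub xA] .
  show ?thesis
    unfolding S.discrete_at_def
  proof (intro conjI ballI impI)
    show "subring (h ` A) S" using img_is_subring[OF sub] .
    show "h x \<in> h ` A" using xA by simp
  next
    fix a b c assume "a \<in> h ` A" "b \<in> h ` A" "c \<in> h ` A" and eq: "a \<otimes>\<^bsub>S\<^esub> b = h x \<otimes>\<^bsub>S\<^esub> c"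
    then obtain a' b' c' where abc: "a' \<in> A" "b' \<in> A" "c' \<in> A" "a = h a'" "b = h b'" "c = h c'"
      by blast
    then have "h (a' \<otimes> b') = h (x \<otimes> c')" using eq mult xA by simp
    then have "a' \<otimes> b' = x \<otimes> c'" using inj' cl abc xA by blast
    then obtain d where "d \<in> A" "a' = x \<otimes> d \<or> b' = x \<otimes> d"
      using R.discrete_atD(3)[OF A abc(1-3)] by blast
    then show "\<exists>d\<in>h ` A. a = h x \<otimes>\<^bsub>S\<^esub> d \<or> b = h x \<otimes>\<^bsub>S\<^esub> d"
      using mult[OF xA] abc by auto
  next
    fix a assume "a \<in> h ` A - {\<zero>\<^bsub>S\<^esub>}"
    then obtain a' where a': "a' \<in> A" "a = h a'" "a' \<noteq> \<zero>"
      using hom_zero by blast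
    obtain k :: nat where k: "\<forall>b\<in>A. a' \<noteq> x [^] k \<otimes> b"
      using R.discrete_atD(4)[OF A a'(1,3)] by blast
    have "a \<noteq> h x [^]\<^bsub>S\<^esub> k \<otimes>\<^bsub>S\<^esub> b" if b: "b \<in> h ` A" for b
    proof
      assume eq: "a = h x [^]\<^bsub>S\<^esub> k \<otimes>\<^bsub>S\<^esub> b"
      obtain b' where b': "b' \<in> A" "b = h b'" using b by blast
      then have "h a' = h (x [^] k \<otimes> b')" using eq a' mult[OF xk] pow by simp
      then have "a' = x [^] k \<otimes> b'" using inj' a' b' cl[OF xk] by blast
      then show False using k b' by blast
    qed
    then show "\<exists>k::nat. \<forall>b\<in>h ` A. a \<noteq> h x [^]\<^bsub>S\<^esub> k \<otimes>\<^bsub>S\<^esub> b" by blast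
  qed
qed

text \<open>Krull's argument: if neither factor of a product in \<open>P\<close> were in
  \<open>P\<close>, both enlarged ideals would meet \<open>M\<close>, and the product of the two
  witnesses would lie in \<open>P\<close> and in \<open>M\<close>.\<close>

lemma (in cring) exists_primeideal_disjoint:
  assumes I: "ideal I R" and M: "M \<subseteq> carrier R" "\<one> \<in> M" "\<And>a b. a \<in> M \<Longrightarrow> b \<in> M \<Longrightarrow> a \<otimes> b \<in> M"
    and disj: "I \<inter> M = {}"
  obtains P where "primeideal P R" "I \<subseteq> P" "P \<inter> M = {}"
proof -
  define F where "F = {J. ideal J R \<and> I \<subseteq> J \<and> J \<inter> M = {}}"
  have "\<exists>P\<in>F. \<forall>J\<in>F. P \<subseteq> J \<longrightarrow> J = P"
  proof (rule subset_Zorn_nonempty)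
    show "F \<noteq> {}" using I disj unfolding F_def by blast
    fix C assume C: "C \<noteq> {}" "subset.chain F C"
    have "subset.chain {I. ideal I R} C"
      using C(2) unfolding subset_chain_def F_def by auto
    then have "ideal (\<Union>C) R" using chain_Union_is_ideal[of C] C(1) by simp
    moreover have "I \<subseteq> J" "J \<inter> M = {}" if "J \<in> C" for J
      using C(2) that unfolding subset_chain_def F_def by auto
    ultimately show "\<Union>C \<in> F" using C(1) unfolding F_def by blast
  qed
  then obtain P where P: "P \<in> F" and max: "\<forall>J\<in>F. P \<subseteq> J \<longrightarrow> J = P" by (rule bexE)
  have idl: "ideal P R" and IP: "I \<subseteq> P" and PM: "P \<inter> M = {}" using P unfolding F_def by auto
  interpret P: ideal P R by (rule idl)
  have meets: "\<exists>p\<in>P. \<exists>r\<in>carrier R. p \<oplus> r \<otimes> a \<in> M" if a: "a \<in> carrier R" "a \<notin> P" for a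
  proof -
    let ?J = "P <+>\<^bsub>R\<^esub> PIdl a"
    have J: "ideal ?J R" using add_ideals[OF idl cgenideal_ideal[OF a(1)]] .
    have Jmem: "p \<oplus> r \<otimes> a \<in> ?J" if "p \<in> P" "r \<in> carrier R" for p r
      using that unfolding set_add_def' cgenideal_def by blast
    have "P \<subseteq> ?J"
    proof
      fix p assume p: "p \<in> P"
      have "p \<oplus> \<zero> \<otimes> a = p" using p a(1) by simp
      then show "p \<in> ?J" using Jmem[OF p zero_closed] by simp
    qed
    have "\<zero> \<oplus> \<one> \<otimes> a = a" using a(1) by simp
    then have "a \<in> ?J" using Jmem[OF P.zero_closed one_closed] by simp
    then have "?J \<noteq> P" using a(2) by blast
    then have "?J \<notin> F" using max \<open>P \<subseteq> ?J\<close> by blast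
    then have "?J \<inter> M \<noteq> {}" using J IP \<open>P \<subseteq> ?J\<close> unfolding F_def by blast
    then show ?thesis unfolding set_add_def' cgenideal_def by blast
  qed
  have "primeideal P R"
  proof (rule primeidealI[OF idl cring_axioms])
    show "carrier R \<noteq> P" using M(2) PM by auto
    fix a b assume ab: "a \<in> carrier R" "b \<in> carrier R" "a \<otimes> b \<in> P"
    show "a \<in> P \<or> b \<in> P"
    proof (rule ccontr)
      assume "\<not> (a \<in> P \<or> b \<in> P)"
      then obtain p r q s where *: "p \<in> P" "r \<in> carrier R" "p \<oplus> r \<otimes> a \<in> M"
          "q \<in> P" "s \<in> carrier R" "q \<oplus> s \<otimes> b \<in> M"
        using meets ab by metis
      have c: "p \<in> carrier R" "q \<in> carrier R" using * by auto
      have "(p \<oplus> r \<otimes> a) \<otimes> (q \<oplus> s \<otimes> b)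
          = (q \<oplus> s \<otimes> b) \<otimes> p \<oplus> ((r \<otimes> a) \<otimes> q \<oplus> (r \<otimes> s) \<otimes> (a \<otimes> b))"
        using c *(2,5) ab by algebra
      moreover have "(q \<oplus> s \<otimes> b) \<otimes> p \<oplus> ((r \<otimes> a) \<otimes> q \<oplus> (r \<otimes> s) \<otimes> (a \<otimes> b)) \<in> P"
      proof (intro P.a_closed)
        show "(q \<oplus> s \<otimes> b) \<otimes> p \<in> P" "(r \<otimes> a) \<otimes> q \<in> P" "(r \<otimes> s) \<otimes> (a \<otimes> b) \<in> P"
          using * c ab by (simp_all add: P.I_l_closed)
      qed
      ultimately show False using M(3)[OF *(3,6)] PM by auto
    qed
  qed
  then show thesis using that IP PM by blast
qed

text \<open>A prime ideal above \<open>q\<close> that avoids the nonzero elements of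
  \<open>A\<close> keeps \<open>A\<close> intact in the quotient, where \<open>x\<close> and
  \<open>y\<close> become inverse to each other.\<close>

lemma (in domain) submaximal_if_quotient_unit:
  assumes A: "discrete_at x A" and y: "y \<in> carrier R"
    and q: "q \<in> carrier R" "q divides (\<one> \<ominus> x \<otimes> y)"
    and ndvd: "\<And>a. a \<in> A \<Longrightarrow> q divides a \<Longrightarrow> a = \<zero>"
  shows "submaximal R"
proof -
  note sub = discrete_atD(1)[OF A]
  have Ac: "a \<in> carrier R" if "a \<in> A" for a using that subringE(1)[OF sub] by blast
  have xc: "x \<in> carrier R" using discrete_atD(2)[OF A] Ac by blast
  have disj: "PIdl q \<inter> (A - {\<zero>}) = {}"
  proof -
    have "a = \<zero>" if a: "a \<in> A" "a \<in> PIdl q" for a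
    proof -
      obtain r where "r \<in> carrier R" "a = r \<otimes> q" using a(2) unfolding cgenideal_def by blast
      then have "q divides a" using q(1) by (intro dividesI[of r]) (simp_all add: m_comm)
      then show ?thesis using ndvd a(1) by blast
    qed
    then show ?thesis by blast
  qed
  have A0: "a \<otimes> b \<in> A - {\<zero>}" if "a \<in> A - {\<zero>}" "b \<in> A - {\<zero>}" for a b
    using that subringE(6)[OF sub] Ac by (auto simp: integral_iff)
  obtain P where P: "primeideal P R" "PIdl q \<subseteq> P" "P \<inter> (A - {\<zero>}) = {}"
  proof (rule exists_primeideal_disjoint[OF cgenideal_ideal[OF q(1)] _ _ A0 disj])
    show "A - {\<zero>} \<subseteq> carrier R" using Ac by blast
    show "\<one> \<in> A - {\<zero>}" using subringE(3)[OF sub] by simp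
  qed
  interpret P: primeideal P R by (rule P(1))
  interpret Q: domain "R Quot P" by (rule P.quotient_is_domain)
  interpret h: ring_hom_ring R "R Quot P" "(+>) P" by (rule P.rcos_ring_hom_ring)
  have "inj_on ((+>) P) A"
  proof (rule inj_onI)
    fix a b assume ab: "a \<in> A" "b \<in> A" "P +> a = P +> b"
    then have "a \<ominus> b \<in> P"
      using quotient_eq_iff_same_a_r_cos[OF P.is_ideal] Ac by blast
    moreover have "a \<ominus> b \<in> A"
      unfolding a_minus_def using ab subringE(5,7)[OF sub] by blast
    ultimately have "a \<ominus> b = \<zero>" using P(3) by blast
    then show "a = b" using ab Ac by simp
  qed
  then have "Q.discrete_at (P +> x) ((+>) P ` A)"
    by (rule h.discrete_at_image[OF A])
  moreover have "P +> x \<in> Units (R Quot P)"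
  proof -
    obtain r where r: "r \<in> carrier R" "\<one> \<ominus> x \<otimes> y = q \<otimes> r" using q(2) by (rule dividesE)
    then have "\<one> \<ominus> x \<otimes> y \<in> P"
      using P(2) cgenideal_self[OF q(1)] P.I_r_closed by auto
    then have "P +> \<one> = P +> (x \<otimes> y)"
      using quotient_eq_iff_same_a_r_cos[OF P.is_ideal] xc y by simp
    then have "(P +> x) \<otimes>\<^bsub>R Quot P\<^esub> (P +> y) = \<one>\<^bsub>R Quot P\<^esub>"
      using xc y h.hom_one h.hom_mult by metis
    then show ?thesis
      unfolding Units_def using h.hom_closed[OF xc] h.hom_closed[OF y] Q.m_comm
      by (metis (mono_tags, lifting) mem_Collect_eq)
  qed
  ultimately have "submaximal (R Quot P)"
    using Q.submaximal_if_discrete_at_unit by blast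
  moreover have "(+>) P ` carrier R = carrier (R Quot P)"
    unfolding FactRing_def A_RCOSETS_def' by auto
  ultimately show ?thesis
    using h.submaximal_vimage by blast
qed

section \<open>Countability, atomicity and irreducible factors\<close>

lemma (in cring) countable_simple_extension:
  assumes "countable B"
  shows "countable (simple_extension B y)"
proof -
  have "countable (bounded_polys B y n)" for n
  proof (induction n)
    case (Suc n)
    have "bounded_polys B y (Suc n) = (\<lambda>(g, a). g \<otimes> y \<oplus> a) ` (bounded_polys B y n \<times> B)"
      by (auto simp: bounded_polys.simps(2))
    then show ?case using Suc assms by simp
  qed simp
  then show ?thesis unfolding simple_extension_eq_UN by blast
qed

text \<open>There are countably many polynomials over \<open>B\<close>, each with finitely many
  roots.\<close>

lemma (in domain) countable_not_free_over:
  assumes B: "subring B R" "countable B"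
  shows "countable {y \<in> carrier R. \<not> free_over B y}"
proof -
  let ?L = "{p \<in> lists B. p \<in> carrier (poly_ring R)}"
  have Bc: "b \<in> carrier R" if "b \<in> B" for b using that subringE(1)[OF B(1)] by blast
  \<comment> \<open>Coefficient lists put the highest degree first, so a Horner step appends the new
    constant at the end. Such a list may start with zeros; it becomes a polynomial once the nonzero
    \<open>c\<close> is put in front, and \<open>length l = n\<close> gives \<open>c\<close> the
    right degree.\<close>
  have ev: "\<exists>l\<in>lists B. length l = n \<and> eval l y = g"
    if "y \<in> carrier R" "g \<in> bounded_polys B y n" for g y n
    using that(2)
  proof (induction n arbitrary: g)
    case (Suc n)
    obtain g' a where g': "g' \<in> bounded_polys B y n" "a \<in> B" "g = g' \<otimes> y \<oplus> a"
      using bounded_polys_SucE[OF Suc.prems] by metis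
    obtain l where l: "l \<in> lists B" "length l = n" "eval l y = g'"
      using Suc.IH[OF g'(1)] by blast
    have "set l \<subseteq> carrier R" using l(1) Bc by auto
    then have "eval (l @ [a]) y = g"
      using eval_append_aux[of l a y] g' l(3) that(1) Bc by simp
    then show ?case using l g'(2) by (intro bexI[of _ "l @ [a]"]) auto
  qed auto
  have "{y \<in> carrier R. \<not> free_over B y} \<subseteq> (\<Union>p\<in>?L. {y. is_root p y})"
  proof
    fix y assume "y \<in> {y \<in> carrier R. \<not> free_over B y}"
    then have y: "y \<in> carrier R" "\<not> free_over B y" by auto
    obtain n c where c: "c \<in> B" "c \<noteq> \<zero>" "c \<otimes> y [^] (n::nat) \<in> bounded_polys B y n"
      using not_free_over_lead[OF B(1) y] by metis
    obtain l where l: "l \<in> lists B" "length l = n" "eval l y = \<ominus> (c \<otimes> y [^] n)"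
      using ev[OF y(1) bounded_polys_uminus[OF B(1) y(1) c(3)]] by blast
    have "eval (c # l) y = \<zero>"
      using l(2,3) c(1) Bc y(1) by (simp add: r_neg)
    moreover have "c # l \<in> ?L"
      using l(1) c Bc unfolding univ_poly_carrier[symmetric] polynomial_def by auto
    ultimately show "y \<in> (\<Union>p\<in>?L. {y. is_root p y})"
      using y(1) unfolding is_root_def by blast
  qed
  moreover have "countable ?L"
    using countable_lists[OF B(2)] by (rule countable_subset[rotated]) blast
  then have "countable (\<Union>p\<in>?L. {y. is_root p y})"
    using finite_number_of_roots by (intro countable_UN) (auto intro: countable_finite)
  ultimately show ?thesis by (rule countable_subset)
qed

lemma (in domain) countable_prime_subring: "countable (prime_subring R)"
  unfolding prime_subring_def by simp

text \<open>Only countably many units are algebraic over the prime subring, so a transcendental one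
  remains.\<close>

lemma (in domain) submaximal_if_uncountable_Units:
  assumes "uncountable (Units R)"
  shows "submaximal R"
proof -
  let ?Z = "prime_subring R"
  have "\<not> Units R \<subseteq> {y \<in> carrier R. \<not> free_over ?Z y}"
    using assms countable_subset countable_not_free_over[OF prime_subring_is_subring countable_prime_subring]
    by blast
  then obtain y where y: "y \<in> Units R" "free_over ?Z y" by auto
  have yc: "y \<in> carrier R" "inv y \<in> carrier R" using y(1) by auto
  have "y \<noteq> \<zero>" using Units_r_inv[OF y(1)] yc(2) by auto
  then show ?thesis
    using submaximal_if_discrete_at_unit[OF y(1)]
      discrete_at_transcendental[OF prime_subring_is_subring yc(1) _ y(2)] by blast
qed

text \<open>Factorization in the multiplicative monoid yields a product only associated to
  \<open>a\<close>. The missing unit is absorbed into the first factor, which exists because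
  \<open>a\<close> is not a unit.\<close>

lemma (in noetherian_domain) noetherian_domain_is_atomic: "atomic_domain R"
  unfolding atomic_domain_def
proof (intro conjI ballI)
  show "domain R" by (rule domain_axioms)
  fix a assume a: "a \<in> carrier R - {\<zero>} - Units R"
  then obtain fs where fs: "set fs \<subseteq> carrier (mult_of R)" "wfactors (mult_of R) fs a"
    using factorization_property by blast
  have fold: "foldr (\<otimes>) fs \<one> \<in> carrier R"
    using fs(1) by (induction fs) auto
  have irr: "\<forall>f\<in>set fs. irreducible (mult_of R) f"
    and assoc: "foldr (\<otimes>) fs \<one> \<sim>\<^bsub>mult_of R\<^esub> a"
    using fs(2) unfolding wfactors_def by auto
  have irr': "ring_irreducible f" if "f \<in> carrier R - {\<zero>}" "irreducible (mult_of R) f" for f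
    using that ring_irreducibleI' by blast
  have "fs \<noteq> []"
  proof
    assume "fs = []"
    then have "\<one> \<sim> a" using assoc assoc_iff_assoc_mult a by auto
    then show False using a Units_cong by blast
  qed
  then obtain f gs where fgs: "fs = f # gs" by (cases fs) auto
  obtain u where u: "u \<in> Units R" "a = u \<otimes> foldr (\<otimes>) fs \<one>"
    using assoc assoc_iff_assoc_mult ring_associated_iff a fold by (metis DiffD1 associated_sym)
  have gs: "foldr (\<otimes>) gs \<one> \<in> carrier R" and fc: "f \<in> carrier R"
    using fs(1) unfolding fgs by (induction gs) auto
  have uc: "u \<in> carrier R" using u(1) by auto
  have "a = (u \<otimes> f) \<otimes> foldr (\<otimes>) gs \<one>"
    using u(2) uc fc gs unfolding fgs by (simp add: m_assoc)
  then have "u \<otimes> f \<noteq> \<zero>"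
    using a gs by auto
  moreover have "irreducible R f"
    using irr irreducible_mult_imp_irreducible fs(1) unfolding fgs by auto
  ultimately have "ring_irreducible (u \<otimes> f)"
    using irreducible_prod_lI[of f u] u fc unfolding ring_irreducible_def by blast
  then show "\<exists>fs. set fs \<subseteq> carrier R \<and> (\<forall>f\<in>set fs. ring_irreducible f) \<and> foldr (\<otimes>) fs \<one> = a"
    using u fc gs irr irr' fs(1) unfolding fgs by (intro exI[of _ "(u \<otimes> f) # gs"]) (auto simp: m_assoc)
qed

text \<open>An associate class is an orbit of the unit group. This turns counting up to associates
  into counting elements.\<close>

lemma (in domain) countable_assocs_fibre:
  assumes "countable (Units R)" and q: "q \<in> carrier R"
  shows "countable {r \<in> carrier R. assocs R r = assocs R q}"
proof -
  have "{r \<in> carrier R. assocs R r = assocs R q} \<subseteq> (\<lambda>u. u \<otimes> q) ` Units R"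
  proof
    fix r assume "r \<in> {r \<in> carrier R. assocs R r = assocs R q}"
    then have r: "r \<in> carrier R" "assocs R q = assocs R r" by auto
    have "r \<in> assocs R q" using assocs_repr_independenceD[OF r(2,1)] .
    then have "r \<sim> q" unfolding eq_closure_of_def elem_def by auto
    then show "r \<in> (\<lambda>u. u \<otimes> q) ` Units R" using ring_associated_iff[OF r(1) q] by auto
  qed
  then show ?thesis using assms(1) by (rule countable_subset[OF _ countable_image])
qed

text \<open>The map sending \<open>y\<close> to \<open>\<one> \<ominus> x \<otimes> y\<close> is
  injective, so it has uncountably many values, while units and finite products from
  \<open>I\<close> are countably many. A value escaping both has a factor outside
  \<open>I\<close>.\<close>

lemma (in domain) irreducible_factor_outside:
  assumes atomic: "atomic_domain R" and unc: "uncountable (carrier R)"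
    and units: "countable (Units R)" and I: "countable I"
    and x: "x \<in> carrier R" "x \<noteq> \<zero>" "x \<notin> Units R"
  obtains y q where "y \<in> carrier R" "q \<in> carrier R" "ring_irreducible q" "q \<notin> I"
    "q divides (\<one> \<ominus> x \<otimes> y)"
proof -
  let ?f = "\<lambda>y. \<one> \<ominus> x \<otimes> y"
  let ?P = "(\<lambda>fs. foldr (\<otimes>) fs \<one>) ` lists I"
  have "inj_on ?f (carrier R)"
  proof (rule inj_onI)
    fix y z assume yz: "y \<in> carrier R" "z \<in> carrier R" "?f y = ?f z"
    have "x \<otimes> y = \<one> \<ominus> ?f y" "x \<otimes> z = \<one> \<ominus> ?f z" using x(1) yz(1,2) by algebra+
    then have "x \<otimes> y = x \<otimes> z" using yz(3) by simp
    then show "y = z" using m_lcancel[OF x(2,1) yz(1,2)] by simp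
  qed
  then have "uncountable (?f ` carrier R)"
    using unc countable_image_inj_on by blast
  moreover have "countable (Units R \<union> ?P)"
    using units countable_lists[OF I] by simp
  ultimately have "\<not> ?f ` carrier R \<subseteq> Units R \<union> ?P"
    using countable_subset by blast
  then obtain y where y: "y \<in> carrier R" "?f y \<notin> Units R" "?f y \<notin> ?P" by blast
  \<comment> \<open>Here \<open>x\<close> being a nonunit matters: a zero value would make
    \<open>y\<close> its inverse.\<close>
  have "?f y \<noteq> \<zero>"
  proof
    assume "?f y = \<zero>"
    then have "x \<otimes> y = \<one>" using x(1) y(1) by simp
    then have "x \<in> Units R" using unit_factor[of x y] x(1) y(1) by simp
    then show False using x(3) by simp
  qed
  then have "?f y \<in> carrier R - {\<zero>} - Units R" using x(1) y by simp
  then obtain fs where fs: "set fs \<subseteq> carrier R" "\<forall>f\<in>set fs. ring_irreducible f"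
      "foldr (\<otimes>) fs \<one> = ?f y"
    using atomic unfolding atomic_domain_def by blast
  have "\<not> set fs \<subseteq> I"
  proof
    assume "set fs \<subseteq> I"
    then have "fs \<in> lists I" by auto
    then have "?f y \<in> ?P" using fs(3) by (intro image_eqI[of _ _ fs]) simp_all
    then show False using y(3) by simp
  qed
  then obtain q where q: "q \<in> set fs" "q \<notin> I" by blast
  have "foldr (\<otimes>) gs \<one> \<in> carrier R \<and> (q \<in> set gs \<longrightarrow> q divides (foldr (\<otimes>) gs \<one>))"
    if "set gs \<subseteq> carrier R" for gs
    using that
  proof (induction gs)
    case (Cons g gs)
    then show ?case by (auto intro: divides_prod_r divides_prod_l)
  qed simp
  then have "q divides ?f y" using fs q(1) by metis
  then show thesis using that y(1) q fs(1,2) by blast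
qed

text \<open>With countably many units, the irreducible divisors of nonzero elements of the countable
  set \<open>A\<close> form a countable set. An irreducible outside it divides no nonzero element of
  \<open>A\<close>, which is what the quotient construction needs.\<close>

lemma (in domain) submaximal_if_countable_divisor_classes:
  assumes atomic: "atomic_domain R" and unc: "uncountable (carrier R)"
    and p: "p \<in> carrier R" "p \<noteq> \<zero>" "p \<notin> Units R"
    and cnt: "\<And>a. a \<in> simple_extension (prime_subring R) p - {\<zero>} \<Longrightarrow>
      countable (irreducible_divisor_classes R a)"
  shows "submaximal R"
proof (cases "countable (Units R)")
  case False
  then show ?thesis by (rule submaximal_if_uncountable_Units)
next
  case True
  obtain x A where A: "discrete_at x A" "x \<noteq> \<zero>" "x \<notin> Units R"
      "A \<subseteq> simple_extension (prime_subring R) p"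
    using exists_discrete_at_nonunit[OF p] by metis
  have xc: "x \<in> carrier R"
    using discrete_atD(2)[OF A(1)] subringE(1)[OF discrete_atD(1)[OF A(1)]] by blast
  have cA: "countable A"
    using A(4) countable_simple_extension[OF countable_prime_subring] by (rule countable_subset)
  define I where "I = {q \<in> carrier R. ring_irreducible q \<and> (\<exists>a\<in>A - {\<zero>}. q divides a)}"
  have "assocs R ` I \<subseteq> (\<Union>a\<in>A - {\<zero>}. irreducible_divisor_classes R a)"
    unfolding I_def irreducible_divisor_classes_def by blast
  moreover have "countable (\<Union>a\<in>A - {\<zero>}. irreducible_divisor_classes R a)"
    using cA cnt A(4) by (intro countable_UN) auto
  ultimately have "countable (assocs R ` I)" by (rule countable_subset)
  moreover have "countable {r \<in> carrier R. assocs R r = c}" if c: "c \<in> assocs R ` I" for c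
  proof -
    obtain q where "q \<in> carrier R" "c = assocs R q" using c unfolding I_def by blast
    then show ?thesis using countable_assocs_fibre[OF True] by simp
  qed
  ultimately have "countable (\<Union>c\<in>assocs R ` I. {r \<in> carrier R. assocs R r = c})"
    by (rule countable_UN)
  moreover have "I \<subseteq> (\<Union>c\<in>assocs R ` I. {r \<in> carrier R. assocs R r = c})"
    unfolding I_def by blast
  ultimately have "countable I" by (rule countable_subset[rotated])
  from irreducible_factor_outside[OF atomic unc True this xc A(2,3)]
  obtain y q where q: "y \<in> carrier R" "q \<in> carrier R" "ring_irreducible q" "q \<notin> I"
    "q divides (\<one> \<ominus> x \<otimes> y)" by metis
  have "a = \<zero>" if "a \<in> A" "q divides a" for a
    using that q(2-4) unfolding I_def by blast
  then show ?thesis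
    by (rule submaximal_if_quotient_unit[OF A(1) q(1,2,5)])
qed

text \<open>Countably many units together with zero cannot exhaust the ring, so a nonzero nonunit is
  available as \<open>p\<close>.\<close>

lemma (in domain) submaximal_if_all_countable_divisor_classes:
  assumes atomic: "atomic_domain R" and unc: "uncountable (carrier R)"
    and cnt: "\<And>a. a \<in> carrier R - {\<zero>} \<Longrightarrow> countable (irreducible_divisor_classes R a)"
  shows "submaximal R"
proof (cases "countable (Units R)")
  case False
  then show ?thesis by (rule submaximal_if_uncountable_Units)
next
  case True
  then have "countable (insert \<zero> (Units R))" by simp
  then have "\<not> carrier R \<subseteq> insert \<zero> (Units R)" using unc countable_subset by blast
  then obtain p where p: "p \<in> carrier R" "p \<noteq> \<zero>" "p \<notin> Units R" by blast
  have "simple_extension (prime_subring R) p \<subseteq> carrier R"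
    using subringE(1)[OF simple_extension_is_subring[OF prime_subring_is_subring p(1)]] .
  then show ?thesis
    using submaximal_if_countable_divisor_classes[OF atomic unc p] cnt by blast
qed

text \<open>The idf condition speaks only of nonunits; this covers the units when passing to all
  nonzero elements.\<close>

lemma (in domain) irreducible_divisor_classes_unit:
  assumes "a \<in> Units R"
  shows "irreducible_divisor_classes R a = {}"
proof -
  have False if "q \<in> carrier R" "ring_irreducible q" "q divides a" for q
    using divides_unit[OF that(3,1) assms] ring_irreducibleE(4)[OF that(1,2)] by blast
  then show ?thesis unfolding irreducible_divisor_classes_def by blast
qed

theorem proposition2p4:
  fixes D :: "('a, 'b) ring_scheme" (structure)
  assumes "domain D" and "uncountable (carrier D)"
  shows
    "((atomic_domain D \<or> noetherian_domain D) \<and>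
      (\<exists>p \<in> carrier D.
         ring_irreducible p \<and> \<one> \<ominus> p \<notin> Units D \<and>
         (\<forall>x \<in> ring.simple_extension D (prime_subring D) p - {\<zero>}.
            countable (irreducible_divisor_classes D x)))
      \<longrightarrow> submaximal D) \<and>
     ((atomic_domain D \<or> noetherian_domain D) \<and>
      (\<forall>x \<in> carrier D - {\<zero>}. countable (irreducible_divisor_classes D x))
      \<longrightarrow> submaximal D) \<and>
     (noetherian_domain D \<and> idf_domain D \<longrightarrow> submaximal D)"
proof -
  interpret domain D by fact
  have atomic: "atomic_domain D" if "atomic_domain D \<or> noetherian_domain D"
    using that noetherian_domain.noetherian_domain_is_atomic by blast
  have idf: "countable (irreducible_divisor_classes D x)"
    if "idf_domain D" "x \<in> carrier D - {\<zero>}" for x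
  proof (cases "x \<in> Units D")
    case True
    then show ?thesis using irreducible_divisor_classes_unit by simp
  next
    case False
    then have "finite (irreducible_divisor_classes D x)"
      using that unfolding idf_domain_def by simp
    then show ?thesis by (rule countable_finite)
  qed
  show ?thesis
  proof (intro conjI impI)
    assume "(atomic_domain D \<or> noetherian_domain D) \<and>
      (\<exists>p \<in> carrier D.
         ring_irreducible p \<and> \<one> \<ominus> p \<notin> Units D \<and>
         (\<forall>x \<in> ring.simple_extension D (prime_subring D) p - {\<zero>}.
            countable (irreducible_divisor_classes D x)))"
    then obtain p where at: "atomic_domain D" and p: "p \<in> carrier D" "ring_irreducible p"
      and cnt: "\<forall>x \<in> simple_extension (prime_subring D) p - {\<zero>}.
            countable (irreducible_divisor_classes D x)"
      using atomic by blast
    show "submaximal D"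
      using submaximal_if_countable_divisor_classes[OF at assms(2) p(1) ring_irreducibleE(1,4)[OF p]]
        cnt by blast
  next
    assume "(atomic_domain D \<or> noetherian_domain D) \<and>
      (\<forall>x \<in> carrier D - {\<zero>}. countable (irreducible_divisor_classes D x))"
    then show "submaximal D"
      by (intro submaximal_if_all_countable_divisor_classes[OF atomic assms(2)]) simp_all
  next
    assume "noetherian_domain D \<and> idf_domain D"
    then show "submaximal D"
      by (intro submaximal_if_all_countable_divisor_classes[OF atomic assms(2)] idf) simp_all
  qed
qed

end
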